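(* Let $p\in\{1,2,\infty\}$. Let $A\in\mathbb{C}^{n\times n}$ be diagonalizable, $A=PDP^{-1}$ with $P$ nonsingular and $D=\operatorname{diag}(\lambda_1,\ldots,\lambda_n)$, and suppose that all eigenvalues of $A$ have positive real parts, that is, $\widetilde{\alpha}(A):=\min\{\Re(\lambda):\lambda\in\sigma(A)\}>0$. Let $a\ge 3$ be real and let $$\mathcal{E}_a(A):=\frac{\|\Gamma(A)-G_a(A)\|_p}{\|\Gamma(A)\|_p}$$ be the relative truncation error of the Spouge approximation $G_a(A)$ to $\Gamma(A)$. Then $$\mathcal{E}_a(A)\;\le\;\kappa_p(P)\,\frac{\sqrt{a}}{(2\pi)^{a-1/2}\,\big(\widetilde{\alpha}(A)-1+a\big)}.$$
   Context: $\sigma(A)$ is the spectrum of $A$, $\|\cdot\|_p$ is the matrix $p$-norm, and $\kappa_p(X):=\|X\|_p\|X^{-1}\|_p$. $\Gamma(A)$ is the primary matrix function associated with the scalar gamma function; when all eigenvalues of $A$ have positive real part, $\Gamma(A)=\int_0^\infty e^{-t}\exp((A-I)\log t)\,dt$. Spouge approximation: for real $a>0$ put $m=\lceil a\rceil-1$, $d_0(a)=1$, and for $1\le k\le m$ $$d_k(a)=\frac{1}{\sqrt{2\pi}}\frac{(-1)^{k-1}}{(k-1)!}(a-k)^{k-1/2}e^{a-k}.$$ The scalar Spouge approximation to $\Gamma(z)$ is $$G_a(z):=\sqrt{2\pi}\,(z-1+a)^{z-1/2}e^{-(z-1+a)}\Big[d_0(a)+\sum_{k=1}^m\frac{d_k(a)}{z-1+k}\Big],$$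 with principal powers, and the matrix version is $$G_a(A):=\sqrt{2\pi}\,\big(A+(a-1)I\big)^{A-\frac12 I}e^{-(A+(a-1)I)}\Big[d_0(a)I+\sum_{k=1}^m d_k(a)\big(A+(k-1)I\big)^{-1}\Big],$$ where $X^Y:=e^{\log(X)Y}$ with $\log$ the principal matrix logarithm. *)

theory Defs
  imports "HOL-Analysis.Analysis" "HOL-Computational_Algebra.Polynomial"
begin

text \<open>
  Square matrices have type \<open>complex^'n^'n\<close>, with the library operations \<open>**\<close>, \<open>*v\<close> and
  \<open>matrix_inv\<close>. The class operations \<open>*\<close> and \<open>1\<close> on \<open>vec\<close>, and hence \<open>^\<close> and \<open>exp\<close>, are not those
  of the matrix algebra and are never used on matrices below. The scalar matrix \<open>c I\<close> is \<open>mat c\<close>,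
  so the scalar multiple \<open>c X\<close> is written \<open>mat c ** X\<close>.
\<close>

definition mat_pow :: "complex^'n^'n \<Rightarrow> nat \<Rightarrow> complex^'n^'n" where
  "mat_pow A k = (((**) A) ^^ k) (mat 1)"

definition diag_matrix :: "complex^'n \<Rightarrow> complex^'n^'n" where
  "diag_matrix v = (\<chi> i j. if i = j then v $ i else 0)"

definition mat_spectrum :: "complex^'n^'n \<Rightarrow> complex set" where
  "mat_spectrum A = {z. \<exists>x. x \<noteq> 0 \<and> A *v x = z *s x}"

definition min_re_spectrum :: "complex^'n^'n \<Rightarrow> real" where
  "min_re_spectrum A = Min (Re ` mat_spectrum A)"


subsection \<open>Matrix p-norms\<close>

definition vec_pnorm :: "ereal \<Rightarrow> complex^'n \<Rightarrow> real" where
  "vec_pnorm p x =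
     (if p = \<infinity> then Max (range (\<lambda>i. cmod (x $ i)))
      else (\<Sum>i\<in>UNIV. cmod (x $ i) powr real_of_ereal p) powr (1 / real_of_ereal p))"

definition mat_pnorm :: "ereal \<Rightarrow> complex^'n^'n \<Rightarrow> real" where
  "mat_pnorm p A = (SUP x\<in>{x. x \<noteq> 0}. vec_pnorm p (A *v x) / vec_pnorm p x)"

definition cond_num :: "ereal \<Rightarrow> complex^'n^'n \<Rightarrow> real" where
  "cond_num p X = mat_pnorm p X * mat_pnorm p (matrix_inv X)"


subsection \<open>Matrix functions\<close>

definition poly_matrix :: "complex poly \<Rightarrow> complex^'n^'n \<Rightarrow> complex^'n^'n" where
  "poly_matrix q A = (\<Sum>i\<le>degree q. mat (coeff q i) ** mat_pow A i)"

text \<open>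
  The index of an eigenvalue, i.e. the size of its largest Jordan block, is the first exponent at
  which the kernels of the powers of \<open>A - z I\<close> stop growing.
\<close>

definition eig_index :: "complex^'n^'n \<Rightarrow> complex \<Rightarrow> nat" where
  "eig_index A z =
     (LEAST k. {x. mat_pow (A - mat z) k *v x = 0} = {x. mat_pow (A - mat z) (Suc k) *v x = 0})"

text \<open>
  The primary matrix function \<open>f(A)\<close>, defined by Hermite interpolation: it is \<open>q(A)\<close> for any
  polynomial \<open>q\<close> that agrees with \<open>f\<close> at each eigenvalue of \<open>A\<close>, including the derivatives of order
  less than its index. Two such polynomials differ by a multiple of the minimal polynomial of \<open>A\<close>,
  so \<open>q(A)\<close> does not depend on the choice made by \<open>SOME\<close>.
\<close>

definition interpolates_on_spectrum ::
    "complex poly \<Rightarrow> (complex \<Rightarrow> complex) \<Rightarrow> complex^'n^'n \<Rightarrow> bool" where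
  "interpolates_on_spectrum q f A \<longleftrightarrow>
     (\<forall>z\<in>mat_spectrum A. \<forall>j<eig_index A z. (deriv ^^ j) (poly q) z = (deriv ^^ j) f z)"

definition primary_matrix_fun :: "(complex \<Rightarrow> complex) \<Rightarrow> complex^'n^'n \<Rightarrow> complex^'n^'n" where
  "primary_matrix_fun f A = poly_matrix (SOME q. interpolates_on_spectrum q f A) A"

definition Gamma_matrix :: "complex^'n^'n \<Rightarrow> complex^'n^'n" where
  "Gamma_matrix A = primary_matrix_fun Gamma A"

text \<open>\<open>Ln\<close> is the principal scalar logarithm, with imaginary part in \<open>(-pi, pi]\<close>.\<close>

definition log_matrix :: "complex^'n^'n \<Rightarrow> complex^'n^'n" where
  "log_matrix A = primary_matrix_fun Ln A"

text \<open>The series converges in the norm topology of \<open>vec\<close>, that is, entrywise.\<close>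

definition exp_matrix :: "complex^'n^'n \<Rightarrow> complex^'n^'n" where
  "exp_matrix A = (\<Sum>k. (1 / fact k) *\<^sub>R mat_pow A k)"

definition powr_matrix :: "complex^'n^'n \<Rightarrow> complex^'n^'n \<Rightarrow> complex^'n^'n" where
  "powr_matrix X Y = exp_matrix (log_matrix X ** Y)"


subsection \<open>Spouge approximation\<close>

definition spouge_terms :: "real \<Rightarrow> nat" where
  "spouge_terms a = nat (\<lceil>a\<rceil> - 1)"

definition spouge_coeff :: "real \<Rightarrow> nat \<Rightarrow> real" where
  "spouge_coeff a k =
     (if k = 0 then 1
      else 1 / sqrt (2 * pi) * ((-1) ^ (k - 1) / fact (k - 1))
             * (a - real k) powr (real k - 1 / 2) * exp (a - real k))"

definition spouge_matrix :: "real \<Rightarrow> complex^'n^'n \<Rightarrow> complex^'n^'n" where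
  "spouge_matrix a A =
     mat (of_real (sqrt (2 * pi)))
     ** powr_matrix (A + mat (of_real (a - 1))) (A - mat (1 / 2))
     ** exp_matrix (- (A + mat (of_real (a - 1))))
     ** (mat (of_real (spouge_coeff a 0))
         + (\<Sum>k = 1..spouge_terms a.
              mat (of_real (spouge_coeff a k)) ** matrix_inv (A + mat (of_real (real k - 1)))))"

definition spouge_rel_error :: "ereal \<Rightarrow> real \<Rightarrow> complex^'n^'n \<Rightarrow> real" where
  "spouge_rel_error p a A =
     mat_pnorm p (Gamma_matrix A - spouge_matrix a A) / mat_pnorm p (Gamma_matrix A)"

end

theory Submission
  imports Defs "HOL-Complex_Analysis.Complex_Analysis" "HOL-Real_Asymp.Real_Asymp"
begin

no_notation fps_nth (infixl \<open>$\<close> 75)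

text \<open>
  Write \<open>\<zeta> = z - 1 + a\<close> and let \<open>F(\<zeta>)\<close> be \<open>\<Gamma>(z)\<close> divided by \<open>sqrt(2 \<pi>) \<zeta>\<^sup>(z - 1/2) exp(-\<zeta>)\<close>.
  It has simple poles at \<open>a - k\<close>, \<open>1 \<le> k < a\<close>, in the half-plane \<open>Re \<zeta> > 0\<close>, with the Spouge
  coefficients as residues, and tends to 1 at infinity. By the reflection formula \<open>F(\<zeta>)\<close> agrees on
  the imaginary axis, up to a term of size \<open>exp(- 2 \<pi> |Im \<zeta>|)\<close>, with \<open>g(-\<zeta>)\<close>, where
  \<open>g(w) = sqrt(2 \<pi>) w\<^sup>(w + a - 1/2) exp(-w) / \<Gamma>(w + a)\<close> is holomorphic on the right half-plane and
  tends to 1 too. Cauchy's formula on both sides of the axis therefore bounds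
  \<open>F(\<zeta>) - 1 - \<Sum> d\<^sub>k / (\<zeta> - (a - k))\<close> by the integral of the small difference. As \<open>|F| \<ge> 1\<close> where
  \<open>Re z > 0\<close>, this is a bound on the relative error for scalars. A diagonalizable matrix has
  \<open>\<Gamma>(A) - G\<^sub>a(A) = P diag(\<Gamma>(\<lambda>\<^sub>i) - G\<^sub>a(\<lambda>\<^sub>i)) P\<^sup>-\<^sup>1\<close>, while the norm of \<open>\<Gamma>(A)\<close> is at least
  the largest \<open>|\<Gamma>(\<lambda>\<^sub>i)|\<close>.
\<close>


subsection \<open>Stirling's formula in the right half-plane\<close>

text \<open>\<open>F\<close> is \<open>stirling_ratio (1 - a)\<close> and \<open>g\<close> is the
  reciprocal of \<open>stirling_ratio a\<close>, so one Stirling formula with a shift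
  \<open>b\<close> serves both sides of the axis. \<open>F\<close> cannot be continued to the left:
  its cut and infinitely many further poles lie on the negative axis. This is why a second function,
  built on the logarithm of \<open>-\<zeta>\<close>, takes over there. The common boundary then
  contains the origin, a branch point of both. They extend continuously by 0 to it, so it suffices
  to use versions of Cauchy's formula that ask only for continuity on the boundary. On the distant
  sides of the contour the Cauchy kernel balances the length of the path. Hence Stirling's formula
  is needed without a rate, but uniformly up to the imaginary axis. The powers of 2 pi come from the
  axis: there \<open>g\<close> is at most \<open>|y|\<close> to the power \<open>a - 1\<close> over
  \<open>Gamma a\<close>, and against \<open>exp (- 2 * pi * |y|)\<close> this integrates to
  \<open>(2 * pi) powr (- a)\<close> on each half-axis; one more factor 2 pi is that of Cauchy's
  formula.\<close>

definition stirling_ratio :: "real \<Rightarrow> complex \<Rightarrow> complex" where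
  "stirling_ratio b z =
     Gamma (z + of_real b) * exp ((1/2 - of_real b - z) * Ln z + z) / of_real (sqrt (2 * pi))"

text \<open>The logarithm of \<open>stirling_ratio b z / stirling_ratio b (z + 1)\<close> for large \<open>z\<close>.\<close>

definition stirling_increment :: "real \<Rightarrow> complex \<Rightarrow> complex" where
  "stirling_increment b z = (z + of_real b + 1/2) * Ln (1 + 1 / z) - Ln (1 + of_real b / z) - 1"

lemma not_nonpos_Int_Re_nonneg:
  fixes z :: complex
  assumes "Re z \<ge> 0" "z \<noteq> 0"
  shows "z \<notin> \<int>\<^sub>\<le>\<^sub>0"
  using assms by (auto elim!: nonpos_Ints_cases simp: complex_eq_iff)

text \<open>The quotient \<open>w / z\<close> lies in the unit disc, so \<open>1 + w / z\<close> has
  argument strictly below pi/2 in modulus, while that of \<open>z\<close> is at most pi/2: the sum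
  stays within the principal branch.\<close>

lemma Ln_add_small:
  assumes "Re z \<ge> 0" "z \<noteq> 0" "norm w < norm z"
  shows "Ln (z + w) = Ln z + Ln (1 + w / z)"
proof -
  have "norm (w / z) < 1"
    using assms by (simp add: norm_divide)
  hence Re: "Re (1 + w / z) > 0"
    using abs_Re_le_cmod[of "w / z"] by simp
  hence nz: "1 + w / z \<noteq> 0"
    by (metis less_irrefl zero_complex.sel(1))
  have "\<bar>Im (Ln (1 + w / z))\<bar> < pi / 2"
    using Re nz Re_Ln_pos_lt by blast
  moreover have "\<bar>Im (Ln z)\<bar> \<le> pi / 2"
    using assms Re_Ln_pos_le by blast
  ultimately have "Ln (z * (1 + w / z)) = Ln z + Ln (1 + w / z)"
    using assms nz by (intro Ln_times_simple) auto
  moreover have "z * (1 + w / z) = z + w"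
    using assms by (simp add: field_simps)
  ultimately show ?thesis by simp
qed

text \<open>The remainder has derivative \<open>v\<^sup>2 / (1 + v)\<close>. Third order is needed
  because this logarithm gets multiplied by a factor of size \<open>1 / u\<close>, and what is left
  must still be summable along \<open>z + k\<close>.\<close>

lemma Ln_approx_quadratic:
  assumes "norm u \<le> 1/2"
  shows "norm (Ln (1 + u) - u + u\<^sup>2 / 2) \<le> 2 * norm u ^ 3"
proof -
  let ?f = "\<lambda>u. Ln (1 + u) - u + u\<^sup>2 / 2"
  have "norm (?f u - ?f 0) \<le> (2 * norm u ^ 2) * norm (u - 0)"
  proof (rule field_differentiable_bound[where S = "cball 0 (norm u)"
        and f = ?f and f' = "\<lambda>v. v\<^sup>2 / (1 + v)"])
    fix v :: complex assume v: "v \<in> cball 0 (norm u)"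
    hence v': "norm v \<le> 1/2" using assms by simp
    hence Re: "Re (1 + v) > 0" using abs_Re_le_cmod[of v] by simp
    hence "1 + v \<notin> \<real>\<^sub>\<le>\<^sub>0" by (auto simp: complex_nonpos_Reals_iff)
    moreover have nz: "1 + v \<noteq> 0" using Re by (metis less_irrefl zero_complex.sel(1))
    ultimately have "(?f has_field_derivative 1 / (1 + v) - 1 + v) (at v within cball 0 (norm u))"
      by (auto intro!: derivative_eq_intros simp: inverse_eq_divide)
    moreover have "1 / (1 + v) - 1 + v = v\<^sup>2 / (1 + v)"
      using nz by (simp add: field_simps power2_eq_square)
    ultimately show "(?f has_field_derivative v\<^sup>2 / (1 + v)) (at v within cball 0 (norm u))"
      by simp
    have "norm (1 + v) \<ge> 1/2"
      using norm_triangle_ineq2[of 1 "-v"] v' by simp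
    moreover have "(norm v)\<^sup>2 \<le> (norm u)\<^sup>2"
      using v by (intro power_mono) auto
    ultimately have "(norm v)\<^sup>2 * 1 \<le> (norm u)\<^sup>2 * (2 * norm (1 + v))"
      by (intro mult_mono) auto
    thus "norm (v\<^sup>2 / (1 + v)) \<le> 2 * norm u ^ 2"
      using nz by (simp add: norm_divide norm_power field_simps)
  qed auto
  thus ?thesis by (simp add: power3_eq_cube power2_eq_square)
qed

lemma norm_stirling_increment_le:
  assumes "b \<ge> 0" "norm z \<ge> 2" "norm z \<ge> 2 * b"
  shows "norm (stirling_increment b z) \<le> (2 * b\<^sup>2 + 2 * b + 3) / (norm z)\<^sup>2"
proof -
  define u where "u = 1 / z"
  define t where "t = norm u"
  have z: "z \<noteq> 0" using assms by auto
  have t: "t \<le> 1/2" "b * t \<le> 1/2" "t \<ge> 0"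
    using assms z by (auto simp: t_def u_def norm_divide field_simps)
  define r where "r = Ln (1 + u) - u + u\<^sup>2 / 2"
  define s where "s = Ln (1 + of_real b * u) - of_real b * u"
  have r: "norm r \<le> 2 * t ^ 3"
    unfolding r_def t_def using t t_def by (intro Ln_approx_quadratic) simp
  have bu: "norm (of_real b * u) = b * t"
    using assms by (simp add: t_def norm_mult)
  have "norm s \<le> (b * t)\<^sup>2 / (1 - b * t)"
    unfolding s_def bu[symmetric] using t bu by (intro Ln_approx_linear) simp
  also have "\<dots> \<le> (b * t)\<^sup>2 / (1/2)"
    using t by (intro divide_left_mono) auto
  finally have s: "norm s \<le> 2 * b\<^sup>2 * t\<^sup>2" by (simp add: power_mult_distrib)
  \<comment> \<open>In powers of \<open>u\<close> the constant terms cancel, and so do the linear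
    ones, since \<open>b + 1/2 - 1/2 - b = 0\<close>. The exponent \<open>z + b - 1/2\<close> of
    Stirling's formula is chosen for this.\<close>
  have expand: "stirling_increment b z
      = - ((of_real b + 1/2) * u\<^sup>2 / 2) + (1 + (of_real b + 1/2) * u) * (z * r) - s"
  proof -
    have "stirling_increment b z
      = (z + of_real b + 1/2) * (r + u - u\<^sup>2 / 2) - (s + of_real b * u) - 1"
    by (simp add: stirling_increment_def r_def s_def u_def)
    also have "\<dots> = - ((of_real b + 1/2) * u\<^sup>2 / 2) + (1 + (of_real b + 1/2) * u) * (z * r) - s"
    using z by (simp add: u_def field_simps power2_eq_square)
    finally show ?thesis .
  qed
  have split: "norm (- x + y - w) \<le> norm x + norm y + norm w" for x y w :: complex
    using norm_triangle_ineq4[of "- x + y" w] norm_triangle_ineq[of "- x" y] by simp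
  have n1: "norm ((of_real b + 1/2) * u\<^sup>2 / 2) = (b + 1/2) / 2 * t\<^sup>2"
  proof -
    have "norm (of_real b + 1/2 :: complex) = norm (of_real (b + 1/2) :: complex)" by simp
    also have "\<dots> = b + 1/2" using assms unfolding norm_of_real by simp
    finally show ?thesis by (simp add: norm_mult norm_divide norm_power t_def)
  qed
  have n2: "norm ((1 + (of_real b + 1/2) * u) * (z * r)) \<le> (1 + (b + 1/2) / 2) * (2 * t\<^sup>2)"
    unfolding norm_mult[of "1 + (of_real b + 1/2) * u"]
  proof (intro mult_mono)
    have "norm (1 + (of_real b + 1/2) * u) \<le> 1 + norm (of_real b + 1/2 :: complex) * t"
      using norm_triangle_ineq[of 1 "(of_real b + 1/2) * u"] by (simp add: norm_mult t_def)
    moreover have "norm (of_real b + 1/2 :: complex) \<le> b + 1/2"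
      using norm_triangle_ineq[of "of_real b :: complex" "1/2"] assms by simp
    hence "norm (of_real b + 1/2 :: complex) * t \<le> (b + 1/2) * (1/2)"
      using t assms by (intro mult_mono) auto
    ultimately show "norm (1 + (of_real b + 1/2) * u) \<le> 1 + (b + 1/2) / 2" by linarith
    have "norm (z * r) \<le> norm z * (2 * t ^ 3)"
      unfolding norm_mult using r by (intro mult_left_mono) auto
    also have "\<dots> = 2 * t\<^sup>2"
      using z by (simp add: t_def u_def norm_divide field_simps power2_eq_square power3_eq_cube)
    finally show "norm (z * r) \<le> 2 * t\<^sup>2" .
  qed (use assms in auto)
  have "norm (stirling_increment b z)
      \<le> (b + 1/2) / 2 * t\<^sup>2 + (1 + (b + 1/2) / 2) * (2 * t\<^sup>2) + 2 * b\<^sup>2 * t\<^sup>2"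
    unfolding expand using split n1 n2 s by (smt (verit))
  also have "\<dots> = (2 * b\<^sup>2 + 3/2 * b + 11/4) * t\<^sup>2"
    by (simp add: field_simps)
  also have "\<dots> \<le> (2 * b\<^sup>2 + 2 * b + 3) * t\<^sup>2"
    using assms by (intro mult_right_mono) auto
  also have "\<dots> = (2 * b\<^sup>2 + 2 * b + 3) / (norm z)\<^sup>2"
    by (simp add: t_def u_def norm_divide power_divide)
  finally show ?thesis .
qed

lemma stirling_ratio_shift:
  assumes "b \<ge> 0" "Re z \<ge> 0" "norm z > 1" "norm z > b"
  shows "stirling_ratio b z = exp (stirling_increment b z) * stirling_ratio b (z + 1)"
proof -
  have z: "z \<noteq> 0" using assms by auto
  have zb: "z + of_real b \<noteq> 0"
    using assms z by (auto simp: complex_eq_iff)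
  have "exp (Ln z + Ln (1 + of_real b / z)) = exp (Ln (z + of_real b))"
    using Ln_add_small[of z "of_real b"] assms z by simp
  also have "\<dots> = z + of_real b"
    using zb by simp
  finally have G: "Gamma (z + 1 + of_real b)
      = exp (Ln z + Ln (1 + of_real b / z)) * Gamma (z + of_real b)"
    using Gamma_plus1[OF not_nonpos_Int_Re_nonneg, of "z + of_real b"] zb assms
    by (simp add: add_ac)
  have L: "Ln (z + 1) = Ln z + Ln (1 + 1 / z)"
    using assms z by (intro Ln_add_small) auto
  have "exp (stirling_increment b z) * exp (Ln z + Ln (1 + of_real b / z))
        * exp ((1/2 - of_real b - (z + 1)) * Ln (z + 1) + (z + 1))
      = exp ((1/2 - of_real b - z) * Ln z + z)"
    unfolding exp_add[symmetric] L stirling_increment_def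
    by (rule arg_cong[of _ _ exp]) (simp add: algebra_simps)
  thus ?thesis unfolding stirling_ratio_def G by (simp add: mult_ac)
qed

section \<open>Summing the increments along a horizontal ray\<close>

lemma norm_add_of_nat_ge:
  assumes "Re z \<ge> 0"
  shows "norm z \<le> norm (z + of_nat n)" "(norm z + n)\<^sup>2 \<le> 2 * (norm (z + of_nat n))\<^sup>2"
proof -
  have *: "(norm z)\<^sup>2 + (real n)\<^sup>2 \<le> (norm (z + of_nat n))\<^sup>2"
    unfolding cmod_power2 using assms by (simp add: power2_eq_square algebra_simps)
  hence "(norm z)\<^sup>2 \<le> (norm (z + of_nat n))\<^sup>2"
    using zero_le_power2[of "real n"] by linarith
  thus "norm z \<le> norm (z + of_nat n)"
    by (rule power2_le_imp_le) simp
  have "0 \<le> (norm z - n)\<^sup>2" by simp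
  with * show "(norm z + n)\<^sup>2 \<le> 2 * (norm (z + of_nat n))\<^sup>2"
    by (simp add: power2_eq_square algebra_simps)
qed

lemma sum_inverse_square_le:
  fixes r :: real and n :: nat
  assumes "r > 1"
  shows "(\<Sum>k<n. 1 / (r + k)\<^sup>2) \<le> 1 / (r - 1)"
proof -
  have "(\<Sum>k<n. 1 / (r + k)\<^sup>2) \<le> (\<Sum>k<n. 1 / (r + k - 1) - 1 / (r + real (Suc k) - 1))"
  proof (intro sum_mono)
    fix k
    define m where "m = r + real k"
    have m: "m > 1" using assms unfolding m_def by linarith
    have "1 / m\<^sup>2 \<le> 1 / (m * (m - 1))"
      using m by (intro divide_left_mono mult_pos_pos) (auto simp: power2_eq_square)
    also have "\<dots> = 1 / (m - 1) - 1 / m"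
      using m by (simp add: field_simps)
    finally show "1 / (r + k)\<^sup>2 \<le> 1 / (r + k - 1) - 1 / (r + real (Suc k) - 1)"
      by (simp add: m_def)
  qed
  also have "\<dots> = 1 / (r - 1) - 1 / (r + n - 1)"
    by (subst sum_lessThan_telescope') simp
  also have "\<dots> \<le> 1 / (r - 1)" using assms by simp
  finally show ?thesis .
qed

text \<open>For \<open>Re z \<ge> 0\<close> the points \<open>z + k\<close> move away from the
  origin whatever the direction of \<open>z\<close>: their moduli are at least
  \<open>(norm z + k) / sqrt 2\<close>. The increments therefore add up to O(1 / norm z), uniformly
  on the closed half-plane and in the number of steps.\<close>

lemma stirling_ratio_shift_n:
  assumes "b \<ge> 0" "Re z \<ge> 0" "norm z \<ge> 2" "norm z \<ge> 2 * b"
  defines "s \<equiv> (\<lambda>n. \<Sum>k<n. stirling_increment b (z + of_nat k))"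
  shows "stirling_ratio b z = exp (s n) * stirling_ratio b (z + of_nat n)"
    and "norm (s n) \<le> 2 * (2 * b\<^sup>2 + 2 * b + 3) / (norm z - 1)"
    and "summable (\<lambda>k. stirling_increment b (z + of_nat k))"
proof -
  define K where "K = 2 * b\<^sup>2 + 2 * b + 3"
  have K: "K > 0" using assms unfolding K_def
    by (intro add_nonneg_pos add_nonneg_nonneg) auto
  have large: "norm (z + of_nat k) \<ge> 2" "norm (z + of_nat k) \<ge> 2 * b" for k
    using norm_add_of_nat_ge(1)[OF assms(2), of k] assms by auto
  show "stirling_ratio b z = exp (s n) * stirling_ratio b (z + of_nat n)"
  proof (induction n)
    case (Suc n)
    have "stirling_ratio b (z + of_nat n)
        = exp (stirling_increment b (z + of_nat n)) * stirling_ratio b (z + of_nat n + 1)"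
      using assms large[of n] by (intro stirling_ratio_shift) auto
    hence "stirling_ratio b z = exp (s n) * exp (stirling_increment b (z + of_nat n))
        * stirling_ratio b (z + of_nat n + 1)"
      using Suc by (simp only: mult.assoc)
    also have "exp (s n) * exp (stirling_increment b (z + of_nat n)) = exp (s (Suc n))"
      by (simp add: s_def exp_add)
    also have "z + of_nat n + 1 = z + of_nat (Suc n)" by simp
    finally show ?case .
  qed (simp add: s_def)
  have inc: "norm (stirling_increment b (z + of_nat k)) \<le> 2 * K * (1 / (norm z + k)\<^sup>2)" for k
  proof -
    have "norm (stirling_increment b (z + of_nat k)) \<le> K / (norm (z + of_nat k))\<^sup>2"
      unfolding K_def using assms large by (intro norm_stirling_increment_le) auto
    also have "\<dots> \<le> K / ((norm z + k)\<^sup>2 / 2)"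
      using norm_add_of_nat_ge(2)[OF assms(2), of k] K assms
      by (intro divide_left_mono mult_pos_pos zero_less_power half_gt_zero add_pos_nonneg) auto
    finally show ?thesis by (simp add: mult_ac)
  qed
  have partial: "(\<Sum>k<n. norm (stirling_increment b (z + of_nat k))) \<le> 2 * K / (norm z - 1)" for n
  proof -
    have "(\<Sum>k<n. norm (stirling_increment b (z + of_nat k)))
        \<le> (\<Sum>k<n. 2 * K * (1 / (norm z + k)\<^sup>2))"
      by (intro sum_mono inc)
    also have "\<dots> = 2 * K * (\<Sum>k<n. 1 / (norm z + k)\<^sup>2)"
      by (simp add: sum_distrib_left)
    also have "\<dots> \<le> 2 * K * (1 / (norm z - 1))"
      using K assms by (intro mult_left_mono sum_inverse_square_le) auto
    finally show ?thesis by simp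
  qed
  show "norm (s n) \<le> 2 * (2 * b\<^sup>2 + 2 * b + 3) / (norm z - 1)"
    using order_trans[OF norm_sum partial[of n]] by (simp add: s_def K_def)
  show "summable (\<lambda>k. stirling_increment b (z + of_nat k))"
    by (rule summable_norm_cancel[OF summableI_nonneg_bounded[OF _ partial]]) simp
qed

lemma tendsto_Ln_one_plus_divide:
  fixes z :: complex
  shows "(\<lambda>n. Ln (1 + z / of_nat n)) \<longlonglongrightarrow> 0"
    and "(\<lambda>n. of_nat n * Ln (1 + z / of_nat n)) \<longlonglongrightarrow> z"
proof -
  have "(\<lambda>n. z / of_nat n) \<longlonglongrightarrow> 0"
    by (rule lim_const_over_n)
  hence "(\<lambda>n. Ln (1 + z / of_nat n)) \<longlonglongrightarrow> Ln (1 + 0)"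
    by (intro tendsto_intros) auto
  thus "(\<lambda>n. Ln (1 + z / of_nat n)) \<longlonglongrightarrow> 0" by simp
  have "(\<lambda>n. of_nat n * Ln (1 + z / of_nat n) - z) \<longlonglongrightarrow> 0"
  proof (rule Lim_null_comparison)
    obtain N :: nat where N: "norm z * 2 < N" using reals_Archimedean2 by blast
    show "\<forall>\<^sub>F n in sequentially. norm (of_nat n * Ln (1 + z / of_nat n) - z)
        \<le> 2 * (norm z)\<^sup>2 / real n"
      using eventually_gt_at_top[of "max N 1"]
    proof eventually_elim
      case (elim n)
      hence n: "n > 0" "2 * norm z \<le> n" using N by auto
      have small: "norm (z / of_nat n) \<le> 1/2"
        using n by (simp add: norm_divide field_simps)
      have "norm (Ln (1 + z / of_nat n) - z / of_nat n)
          \<le> (norm (z / of_nat n))\<^sup>2 / (1 - norm (z / of_nat n))"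
        using small by (intro Ln_approx_linear) auto
      also have "\<dots> \<le> (norm (z / of_nat n))\<^sup>2 / (1/2)"
        using small by (intro divide_left_mono) auto
      finally have *: "norm (Ln (1 + z / of_nat n) - z / of_nat n) \<le> 2 * (norm z)\<^sup>2 / (real n)\<^sup>2"
        by (simp add: norm_divide power_divide mult.commute)
      have "norm (of_nat n * Ln (1 + z / of_nat n) - z)
          = norm (of_nat n * (Ln (1 + z / of_nat n) - z / of_nat n))"
        using n by (simp add: algebra_simps)
      also have "\<dots> \<le> real n * (2 * (norm z)\<^sup>2 / (real n)\<^sup>2)"
        unfolding norm_mult norm_of_nat using * by (intro mult_left_mono) auto
      also have "\<dots> = 2 * (norm z)\<^sup>2 / real n"
        using n by (simp add: power2_eq_square)
      finally show ?case .
    qed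
    show "(\<lambda>n. 2 * (norm z)\<^sup>2 / real n) \<longlonglongrightarrow> 0"
      by (rule lim_const_over_n)
  qed
  thus "(\<lambda>n. of_nat n * Ln (1 + z / of_nat n)) \<longlonglongrightarrow> z"
    by (rule LIM_zero_cancel)
qed

text \<open>Euler's limit for Gamma in another form: numerator and denominator are both evaluated
  far out, so the still unknown constant of Stirling's formula drops out and the limit is exactly
  1.\<close>

lemma stirling_ratio_quotient_tendsto:
  assumes "b \<ge> 0" "Re z \<ge> 0" "z + of_real b \<noteq> 0"
  shows "(\<lambda>n. stirling_ratio b (z + of_nat n) / stirling_ratio 1 (of_nat n)) \<longlonglongrightarrow> 1"
proof -
  define w where "w = z + of_real b"
  have w: "w \<notin> \<int>\<^sub>\<le>\<^sub>0" "w \<noteq> 0" and Rew: "Re w \<ge> 0"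
    using not_nonpos_Int_Re_nonneg[of w] assms by (auto simp: w_def)
  define L where "L = (\<lambda>n. Ln (1 + z / of_nat n))"
  \<comment> \<open>The factor \<open>inverse (1 + w / n)\<close> removes the last factor
    \<open>w + n\<close> of the Pochhammer symbol of length \<open>n + 1\<close> in
    \<open>Gamma_series\<close>. The exponential collects what is left of the powers once the
    logarithm of \<open>z + n\<close> is expressed by that of \<open>n\<close>.\<close>
  have "(\<lambda>n. Gamma w / Gamma_series w n * inverse (1 + w / of_nat n)
          * exp (z - (z + of_real b - 1/2) * L n - of_nat n * L n)) \<longlonglongrightarrow>
        Gamma w / Gamma w * inverse (1 + 0) * exp (z - (z + of_real b - 1/2) * 0 - z)"
    unfolding L_def using w Gamma_eq_zero_iff
    by (intro tendsto_intros tendsto_Ln_one_plus_divide lim_const_over_n) auto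
  hence "(\<lambda>n. Gamma w / Gamma_series w n * inverse (1 + w / of_nat n)
          * exp (z - (z + of_real b - 1/2) * L n - of_nat n * L n)) \<longlonglongrightarrow> 1"
    using w Gamma_eq_zero_iff[of w] by simp
  moreover obtain N :: nat where N: "norm z < N" using reals_Archimedean2 by blast
  have "\<forall>\<^sub>F n in sequentially. Gamma w / Gamma_series w n * inverse (1 + w / of_nat n)
          * exp (z - (z + of_real b - 1/2) * L n - of_nat n * L n)
        = stirling_ratio b (z + of_nat n) / stirling_ratio 1 (of_nat n)"
    using eventually_gt_at_top[of "max N 1"]
  proof eventually_elim
    case (elim n)
    hence n: "n > 0" "norm z < n" using N by auto
    have wn: "w + of_nat n \<noteq> 0" using Rew n by (auto simp: complex_eq_iff)
    have Gw: "Gamma w \<noteq> 0" using w Gamma_eq_zero_iff by blast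
    have Gwn: "Gamma (w + of_nat n) \<noteq> 0"
      using wn Rew not_nonpos_Int_Re_nonneg[of "w + of_nat n"] by (simp add: Gamma_eq_zero_iff)
    have Lsum: "Ln (z + of_nat n) = Ln (of_nat n) + L n"
      unfolding L_def using n Ln_add_small[of "of_nat n" z] by (simp add: add.commute)
    have ln: "complex_of_real (ln (real n)) = Ln (of_nat n)"
      using n Ln_of_real[of "real n"] by simp
    have "Gamma_series w n = fact n * exp (w * Ln (of_nat n)) / (Gamma (w + of_nat n) / Gamma w * (w + of_nat n))"
      unfolding Gamma_series_def ln[symmetric] using w
      by (simp add: pochhammer_Suc pochhammer_Gamma)
    moreover have "inverse (1 + w / of_nat n) = of_nat n / (w + of_nat n)"
      using n wn by (simp add: field_simps)
    moreover have "A / (F * exp E / (B / A * v)) * (m / v) = B * exp (- E) * m / F"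
      if "A \<noteq> 0" "B \<noteq> 0" "v \<noteq> 0" "F \<noteq> 0" for A B E F m v :: complex
      using that by (simp add: exp_minus field_simps)
    ultimately have 1: "Gamma w / Gamma_series w n * inverse (1 + w / of_nat n)
        = Gamma (w + of_nat n) * exp (- w * Ln (of_nat n)) * of_nat n / fact n"
      using wn Gw Gwn by simp
    have D: "stirling_ratio 1 (of_nat n)
        = fact n * exp ((- 1/2 - of_nat n) * Ln (of_nat n) + of_nat n) / of_real (sqrt (2 * pi))"
      unfolding stirling_ratio_def using Gamma_fact[of n, where 'a = complex] by (simp add: add.commute)
    have "stirling_ratio b (z + of_nat n) / stirling_ratio 1 (of_nat n)
        = Gamma (w + of_nat n) / fact n * (exp ((1/2 - of_real b - (z + of_nat n)) * Ln (z + of_nat n) + (z + of_nat n))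
          / exp ((- 1/2 - of_nat n) * Ln (of_nat n) + of_nat n))"
      unfolding D by (simp add: stirling_ratio_def w_def add_ac)
    also have "exp ((1/2 - of_real b - (z + of_nat n)) * Ln (z + of_nat n) + (z + of_nat n))
          / exp ((- 1/2 - of_nat n) * Ln (of_nat n) + of_nat n)
        = exp (- w * Ln (of_nat n) + Ln (of_nat n) + (z - (z + of_real b - 1/2) * L n - of_nat n * L n))"
      unfolding exp_diff[symmetric] Lsum w_def by (rule arg_cong[of _ _ exp]) (simp add: algebra_simps)
    also have "\<dots> = exp (- w * Ln (of_nat n)) * of_nat n * exp (z - (z + of_real b - 1/2) * L n - of_nat n * L n)"
      unfolding exp_add using n by (subst exp_Ln) simp_all
    finally show ?case unfolding 1 by simp
  qed
  ultimately show ?thesis by (rule Lim_transform_eventually)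
qed

text \<open>Along the integers the ratio is its value at 2 times the exponential of minus a partial
  sum of a convergent series, so the limit exists and is not 0. The starting point 2 meets both
  thresholds, \<open>norm z \<ge> 2\<close> and \<open>norm z \<ge> 2 * b\<close> with
  \<open>b = 1\<close>.\<close>

lemma stirling_ratio_nat_tendsto:
  obtains C where "C \<noteq> 0" "(\<lambda>n. stirling_ratio 1 (of_nat n)) \<longlonglongrightarrow> C"
proof -
  define z :: complex where "z = 2"
  define s where "s = (\<lambda>n. \<Sum>k<n. stirling_increment 1 (z + of_nat k))"
  have z: "Re z \<ge> 0" "norm z \<ge> 2" "norm z \<ge> 2 * 1" "(0::real) \<le> 1" by (auto simp: z_def)
  note shift = stirling_ratio_shift_n[OF z(4,1-3)]
  have "s \<longlonglongrightarrow> suminf (\<lambda>k. stirling_increment 1 (z + of_nat k))"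
    unfolding s_def using shift(3) by (rule summable_LIMSEQ)
  hence "(\<lambda>n. stirling_ratio 1 z * exp (- s n)) \<longlonglongrightarrow>
      stirling_ratio 1 z * exp (- suminf (\<lambda>k. stirling_increment 1 (z + of_nat k)))"
    by (intro tendsto_intros)
  also have "(\<lambda>n. stirling_ratio 1 z * exp (- s n)) = (\<lambda>n. stirling_ratio 1 (of_nat (n + 2)))"
  proof
    fix n
    have "stirling_ratio 1 z = exp (s n) * stirling_ratio 1 (z + of_nat n)"
      unfolding s_def by (rule shift(1))
    thus "stirling_ratio 1 z * exp (- s n) = stirling_ratio 1 (of_nat (n + 2))"
      by (simp add: exp_minus field_simps z_def)
  qed
  finally have "(\<lambda>n. stirling_ratio 1 (of_nat n)) \<longlonglongrightarrow>
      stirling_ratio 1 z * exp (- suminf (\<lambda>k. stirling_increment 1 (z + of_nat k)))"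
    by (rule LIMSEQ_offset)
  moreover have "Gamma (z + of_real 1) \<noteq> 0"
    using not_nonpos_Int_Re_nonneg[of "z + of_real 1"] by (simp add: Gamma_eq_zero_iff z_def)
  hence "stirling_ratio 1 z \<noteq> 0"
    by (simp add: stirling_ratio_def)
  hence "stirling_ratio 1 z * exp (- suminf (\<lambda>k. stirling_increment 1 (z + of_nat k))) \<noteq> 0"
    by simp
  ultimately show ?thesis using that by blast
qed

lemma stirling_ratio_nonzero:
  assumes "b \<ge> 0" "Re z \<ge> 0" "z + of_real b \<noteq> 0"
  shows "stirling_ratio b z \<noteq> 0"
  using assms not_nonpos_Int_Re_nonneg[of "z + of_real b"]
  by (simp add: stirling_ratio_def Gamma_eq_zero_iff)

text \<open>The half-plane is closed because the contours end on the imaginary axis and the constant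
  is computed there. Convergence along this filter is uniform in the direction.\<close>

definition right_at_infinity :: "complex filter" where
  "right_at_infinity = inf at_infinity (principal {z. Re z \<ge> 0})"

lemma eventually_right_at_infinity:
  "eventually P right_at_infinity \<longleftrightarrow> (\<exists>R. \<forall>z. Re z \<ge> 0 \<and> norm z \<ge> R \<longrightarrow> P z)"
  unfolding right_at_infinity_def eventually_inf_principal eventually_at_infinity by auto

lemma eventually_right_at_infinityI:
  assumes "\<And>z. Re z \<ge> 0 \<Longrightarrow> norm z \<ge> R \<Longrightarrow> P z"
  shows "eventually P right_at_infinity"
  using assms unfolding eventually_right_at_infinity by blast

lemma filterlim_norm_right_at_infinity:
  "filterlim norm at_top right_at_infinity"
  unfolding right_at_infinity_def
  by (rule filterlim_mono[OF filterlim_norm_at_top order_refl inf_le1])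

text \<open>Moving from \<open>z\<close> to \<open>z + n\<close> changes the ratio by a factor
  within O(1 / norm z) of 1, for all \<open>n\<close> at once. Letting \<open>n\<close> tend to
  infinity while \<open>z\<close> is fixed replaces the moved value by \<open>C\<close>.\<close>

lemma stirling_ratio_tendsto_const:
  assumes "b \<ge> 0" and C: "C \<noteq> 0" "(\<lambda>n. stirling_ratio 1 (of_nat n)) \<longlonglongrightarrow> C"
  shows "(stirling_ratio b \<longlongrightarrow> C) right_at_infinity"
proof -
  define K where "K = 2 * (2 * b\<^sup>2 + 2 * b + 3)"
  have bound: "norm (C / stirling_ratio b z - 1) \<le> exp (K / (norm z - 1)) * (K / (norm z - 1))"
    if z: "Re z \<ge> 0" "norm z \<ge> 2 + 2 * b" for z
  proof -
    have z': "norm z \<ge> 2" "norm z \<ge> 2 * b" "z \<noteq> 0" using z assms by auto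
    have zb: "z + of_real b \<noteq> 0" using z' z assms by (auto simp: complex_eq_iff)
    define s where "s = (\<lambda>n. \<Sum>k<n. stirling_increment b (z + of_nat k))"
    have shift: "stirling_ratio b z = exp (s n) * stirling_ratio b (z + of_nat n)"
        "norm (s n) \<le> K / (norm z - 1)" for n
      unfolding s_def K_def using stirling_ratio_shift_n[OF assms(1) z(1) z'(1,2)] by blast+
    have nz: "stirling_ratio b z \<noteq> 0" by (rule stirling_ratio_nonzero) (use assms z zb in auto)
    have "(\<lambda>n. stirling_ratio b (z + of_nat n) / stirling_ratio 1 (of_nat n)
          * stirling_ratio 1 (of_nat n)) \<longlonglongrightarrow> 1 * C"
      by (intro tendsto_mult C stirling_ratio_quotient_tendsto) (use assms z zb in auto)
    moreover have "stirling_ratio 1 (of_nat n) \<noteq> 0" for n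
      by (rule stirling_ratio_nonzero) (auto simp: complex_eq_iff)
    ultimately have "(\<lambda>n. stirling_ratio b (z + of_nat n)) \<longlonglongrightarrow> C" by simp
    hence "(\<lambda>n. norm (stirling_ratio b (z + of_nat n) / stirling_ratio b z - 1)) \<longlonglongrightarrow>
        norm (C / stirling_ratio b z - 1)"
      using nz by (intro tendsto_intros)
    moreover have "norm (stirling_ratio b (z + of_nat n) / stirling_ratio b z - 1)
        \<le> exp (K / (norm z - 1)) * (K / (norm z - 1))" for n
    proof -
      have "stirling_ratio b (z + of_nat n) / stirling_ratio b z = exp (- s n)"
        using shift(1)[of n] nz by (simp add: exp_minus field_simps)
      also have "norm (exp (- s n) - 1) \<le> exp (norm (- s n)) * norm (- s n)"
        using Taylor_exp_field[of "- s n" 0] by simp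
      also have "\<dots> \<le> exp (K / (norm z - 1)) * (K / (norm z - 1))"
        using shift(2)[of n] by (intro mult_mono) auto
      finally show ?thesis .
    qed
    ultimately show ?thesis by (blast intro: LIMSEQ_le_const2)
  qed
  have "((\<lambda>x. exp (K / (x - 1)) * (K / (x - 1))) \<longlongrightarrow> 0) at_top" by real_asymp
  hence "((\<lambda>z. exp (K / (norm z - 1)) * (K / (norm z - 1))) \<longlongrightarrow> 0) right_at_infinity"
    by (rule filterlim_compose[OF _ filterlim_norm_right_at_infinity])
  moreover have "\<forall>\<^sub>F z in right_at_infinity.
      norm (C / stirling_ratio b z - 1) \<le> exp (K / (norm z - 1)) * (K / (norm z - 1))"
    using bound by (rule eventually_right_at_infinityI)
  ultimately have "((\<lambda>z. C / stirling_ratio b z - 1) \<longlongrightarrow> 0) right_at_infinity"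
    by (rule Lim_null_comparison[rotated])
  hence "((\<lambda>z. C / stirling_ratio b z) \<longlongrightarrow> 1) right_at_infinity"
    by (rule LIM_zero_cancel)
  hence "((\<lambda>z. C / (C / stirling_ratio b z)) \<longlongrightarrow> C / 1) right_at_infinity"
    by (intro tendsto_intros) auto
  thus ?thesis using C by simp
qed

section \<open>The value of Stirling's constant\<close>

lemma Ln_imaginary:
  assumes "y > 0"
  shows "Ln (\<i> * of_real y) = of_real (ln y) + \<i> * of_real (pi / 2)"
  using assms Ln_times_of_real[of y \<i>] by (simp add: mult.commute Ln_of_real)

text \<open>On the line with real part 1/2 conjugation coincides with
  \<open>z \<mapsto> 1 - z\<close>, so the reflection formula evaluates the squared modulus of
  Gamma.\<close>

lemma norm_Gamma_half_imaginary:
  "norm (Gamma (\<i> * of_real y + of_real (1/2))) = sqrt (pi / cosh (pi * y))"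
proof -
  define z where "z = \<i> * of_real y + of_real (1/2)"
  have "cnj z = 1 - z" by (simp add: z_def complex_eq_iff)
  hence "of_real ((norm (Gamma z))\<^sup>2) = Gamma z * Gamma (1 - z)"
    unfolding complex_norm_square by (simp add: cnj_Gamma)
  also have "\<dots> = of_real pi / sin (of_real pi * z)"
    by (rule Gamma_reflection_complex)
  also have "of_real pi * z = of_real (pi / 2) + \<i> * of_real (pi * y)"
    by (simp add: z_def algebra_simps)
  also have "sin \<dots> = of_real (cosh (pi * y))"
    unfolding sin_add sin_of_real cos_of_real cos_i_times
    by (simp add: cosh_field_def flip: exp_minus exp_of_real)
  finally have "(norm (Gamma z))\<^sup>2 = pi / cosh (pi * y)"
    by (metis of_real_divide of_real_eq_iff)
  thus ?thesis unfolding z_def[symmetric]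
    by (metis norm_ge_zero real_sqrt_unique)
qed

text \<open>The constant is found from the reflection formula on the line \<open>Re z = 1/2\<close>.\<close>

theorem stirling_ratio_tendsto_1:
  assumes "b \<ge> 0"
  shows "(stirling_ratio b \<longlongrightarrow> 1) right_at_infinity"
proof -
  obtain C where C: "C \<noteq> 0" "(\<lambda>n. stirling_ratio 1 (of_nat n)) \<longlonglongrightarrow> C"
    by (rule stirling_ratio_nat_tendsto)
  have "filterlim (\<lambda>y. \<i> * of_real y) right_at_infinity at_top"
    unfolding filterlim_iff eventually_right_at_infinity eventually_at_top_linorder
  proof (intro allI impI, elim exE)
    fix P R assume P: "\<forall>z. 0 \<le> Re z \<and> R \<le> norm z \<longrightarrow> P z"
    show "\<exists>N. \<forall>y\<ge>N. P (\<i> * complex_of_real y)"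
      by (rule exI[of _ "\<bar>R\<bar>"]) (use P in \<open>auto simp: norm_mult\<close>)
  qed
  hence "((\<lambda>y. norm (stirling_ratio (1/2) (\<i> * of_real y))) \<longlongrightarrow> norm C) at_top"
    using stirling_ratio_tendsto_const[of "1/2", OF _ C]
    by (intro tendsto_norm) (rule filterlim_compose, auto)
  moreover have "\<forall>\<^sub>F y in at_top. norm (stirling_ratio (1/2) (\<i> * of_real y))
      = sqrt (pi / cosh (pi * y)) * exp (y * pi / 2) / sqrt (2 * pi)"
    using eventually_gt_at_top[of 0]
  proof eventually_elim
    case (elim y)
    thus ?case
      unfolding stirling_ratio_def norm_divide norm_mult exp_add norm_Gamma_half_imaginary
      by (simp add: Ln_imaginary[OF elim])
  qed
  ultimately have "((\<lambda>y. sqrt (pi / cosh (pi * y)) * exp (y * pi / 2) / sqrt (2 * pi)) \<longlongrightarrow> norm C) at_top"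
    by (rule Lim_transform_eventually)
  moreover have "((\<lambda>y. sqrt (pi / cosh (pi * y)) * exp (y * pi / 2) / sqrt (2 * pi)) \<longlongrightarrow> 1) at_top"
    unfolding cosh_field_def by (real_asymp simp: powr_half_sqrt sqrt_def[symmetric] mult.commute)
  ultimately have "norm C = 1"
    using tendsto_unique trivial_limit_at_top_linorder by blast
  \<comment> \<open>The modulus leaves the phase of \<open>C\<close> open. It is settled by the
    integers, where the ratio is a nonnegative real.\<close>
  moreover have "C \<in> \<real> \<and> Re C \<ge> 0"
  proof -
    have *: "stirling_ratio 1 (of_nat n) \<in> {z. z \<in> \<real> \<and> Re z \<ge> 0}" if "n > 0" for n
    proof -
      have "Ln (of_nat n) = of_real (ln (real n))"
        using that Ln_of_real[of "real n"] by simp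
      hence "stirling_ratio 1 (of_nat n) =
          of_real (fact n * exp ((1/2 - 1 - real n) * ln (real n) + real n) / sqrt (2 * pi))"
        unfolding stirling_ratio_def using Gamma_fact[of n, where 'a = complex]
        by (simp add: add.commute exp_of_real[symmetric] del: exp_of_real)
      thus ?thesis
        by (simp only: mem_Collect_eq Reals_of_real Re_complex_of_real) simp
    qed
    have "closed {z :: complex. z \<in> \<real> \<and> Re z \<ge> 0}"
      using closed_Int[OF closed_complex_Reals closed_halfspace_Re_ge[of 0]]
      by (simp add: Int_def)
    moreover have "\<forall>\<^sub>F n in sequentially. stirling_ratio 1 (of_nat n) \<in> {z. z \<in> \<real> \<and> Re z \<ge> 0}"
      using eventually_gt_at_top[of 0] by eventually_elim (rule *)
    ultimately have "C \<in> {z. z \<in> \<real> \<and> Re z \<ge> 0}"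
      by (rule Lim_in_closed_set[OF _ _ trivial_limit_sequentially C(2)])
    thus ?thesis by simp
  qed
  ultimately have "C = 1"
    by (auto simp: complex_is_Real_iff complex_eq_iff cmod_eq_Re)
  with stirling_ratio_tendsto_const[OF assms C] show ?thesis by simp
qed


subsection \<open>Cauchy's formula on two half-planes\<close>

text \<open>Splitting each \<open>1 / ((z - q) * (z - r))\<close> leaves the new pole
  \<open>r\<close> with the coefficient that the induction hypothesis gives at \<open>z = r\<close>.
  Hence the induction is over arbitrary \<open>z\<close>.\<close>

lemma partial_fraction_simple_poles:
  fixes z :: "'a :: field"
  assumes "finite Q" "Q \<noteq> {}" "z \<notin> Q"
  shows "1 / (\<Prod>q\<in>Q. z - q) = (\<Sum>q\<in>Q. 1 / (\<Prod>q'\<in>Q - {q}. q - q') / (z - q))"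
  using assms
proof (induction Q arbitrary: z rule: finite_ne_induct)
  case (singleton r)
  thus ?case by simp
next
  case (insert r Q)
  let ?W = "\<lambda>q. 1 / (\<Prod>q'\<in>Q - {q}. q - q')"
  have W: "1 / (\<Prod>q'\<in>insert r Q - {q}. q - q') = ?W q / (q - r)" if "q \<in> Q" for q
  proof -
    have "insert r Q - {q} = insert r (Q - {q})" "r \<notin> Q - {q}"
      using insert.hyps that by auto
    thus ?thesis using insert.hyps by simp
  qed
  have "1 / (\<Prod>q\<in>insert r Q. z - q) = 1 / (\<Prod>q\<in>Q. z - q) / (z - r)"
    using insert.hyps by simp
  also have "\<dots> = (\<Sum>q\<in>Q. ?W q / (z - q) / (z - r))"
    using insert.IH[of z] insert.prems by (simp add: sum_divide_distrib)
  also have "\<dots> = (\<Sum>q\<in>Q. ?W q / (r - q) / (z - r) + ?W q / (q - r) / (z - q))"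
  proof (intro sum.cong refl)
    fix q assume q: "q \<in> Q"
    have "w / (z - q) / (z - r) = w / (r - q) / (z - r) + w / (q - r) / (z - q)" for w
    proof -
      have nz: "z - q \<noteq> 0" "z - r \<noteq> 0" "r - q \<noteq> 0"
        using q insert by auto
      have "w / (q - r) = - (w / (r - q))"
        by (metis minus_diff_eq minus_divide_right)
      with nz show ?thesis by (simp add: divide_simps) (simp add: algebra_simps)
    qed
    thus "?W q / (z - q) / (z - r) = ?W q / (r - q) / (z - r) + ?W q / (q - r) / (z - q)" .
  qed
  also have "\<dots> = (\<Sum>q\<in>Q. ?W q / (r - q)) / (z - r) + (\<Sum>q\<in>Q. ?W q / (q - r) / (z - q))"
    by (simp add: sum.distrib sum_divide_distrib)
  also have "(\<Sum>q\<in>Q. ?W q / (r - q)) = 1 / (\<Prod>q\<in>Q. r - q)"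
    using insert.IH[of r] insert.hyps by simp
  also have "(\<Sum>q\<in>Q. ?W q / (q - r) / (z - q))
      = (\<Sum>q\<in>Q. 1 / (\<Prod>q'\<in>insert r Q - {q}. q - q') / (z - q))"
    by (intro sum.cong refl) (simp only: W)
  also have "1 / (\<Prod>q\<in>Q. r - q) = 1 / (\<Prod>q'\<in>insert r Q - {r}. r - q')"
    using insert.hyps by simp
  finally show ?case
    using insert.hyps by simp
qed

text \<open>Partial fractions reduce the claim to Cauchy's formula for single poles, which asks only
  for continuity of \<open>f\<close> on \<open>S\<close>. The path may thus run along the boundary
  of \<open>S\<close>, as it will on the imaginary axis through the branch point at the
  origin.\<close>

lemma Cauchy_integral_formula_simple_poles:
  assumes "continuous_on S f" "convex S" "f holomorphic_on interior S"
    and Q: "finite Q" "Q \<noteq> {}" "Q \<subseteq> interior S"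
    and \<gamma>: "valid_path \<gamma>" "path_image \<gamma> \<subseteq> S - Q" "pathfinish \<gamma> = pathstart \<gamma>"
    and wind: "\<And>q. q \<in> Q \<Longrightarrow> winding_number \<gamma> q = 1"
  shows "((\<lambda>w. f w / (\<Prod>q\<in>Q. w - q)) has_contour_integral
           (2 * pi * \<i> * (\<Sum>q\<in>Q. f q / (\<Prod>q'\<in>Q - {q}. q - q')))) \<gamma>"
proof -
  let ?W = "\<lambda>q. 1 / (\<Prod>q'\<in>Q - {q}. q - q')"
  have "((\<lambda>w. \<Sum>q\<in>Q. ?W q * (f w / (w - q))) has_contour_integral
      (\<Sum>q\<in>Q. ?W q * (2 * pi * \<i> * winding_number \<gamma> q * f q))) \<gamma>"
  proof (intro has_contour_integral_sum has_contour_integral_lmul Q)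
    fix q assume "q \<in> Q"
    thus "((\<lambda>w. f w / (w - q)) has_contour_integral (2 * pi * \<i> * winding_number \<gamma> q * f q)) \<gamma>"
      using assms
      by (intro Cauchy_integral_formula_weak[where S = S and k = "{}"])
         (auto intro: holomorphic_on_imp_differentiable_at)
  qed
  also have "(\<Sum>q\<in>Q. ?W q * (2 * pi * \<i> * winding_number \<gamma> q * f q))
      = 2 * pi * \<i> * (\<Sum>q\<in>Q. f q / (\<Prod>q'\<in>Q - {q}. q - q'))"
    unfolding sum_distrib_left by (intro sum.cong refl) (simp add: wind)
  finally show ?thesis
  proof (rule has_contour_integral_eq)
    fix w assume "w \<in> path_image \<gamma>"
    hence "w \<notin> Q" using \<gamma> by auto
    from partial_fraction_simple_poles[OF Q(1,2) this]
    have "f w * (1 / (\<Prod>q\<in>Q. w - q)) = f w * (\<Sum>q\<in>Q. ?W q / (w - q))" by simp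
    thus "(\<Sum>q\<in>Q. ?W q * (f w / (w - q))) = f w / (\<Prod>q\<in>Q. w - q)"
      by (simp add: sum_distrib_left mult_ac)
  qed
qed

lemma has_contour_integral_rectpath_sides:
  assumes "(f has_contour_integral I) (rectpath a c)"
    and "b = Complex (Re c) (Im a)" "d = Complex (Re a) (Im c)"
  obtains I1 I2 I3 I4 where
    "(f has_contour_integral I1) (linepath a b)" "(f has_contour_integral I2) (linepath b c)"
    "(f has_contour_integral I3) (linepath c d)" "(f has_contour_integral I4) (linepath d a)"
    "I = I1 + I2 + I3 + I4"
proof -
  have *: "(f has_contour_integral I)
      (linepath a b +++ linepath b c +++ linepath c d +++ linepath d a)"
    using assms by (simp add: rectpath_def Let_def)
  hence int: "f contour_integrable_on linepath a b" "f contour_integrable_on linepath b c"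
      "f contour_integrable_on linepath c d" "f contour_integrable_on linepath d a"
    by (auto dest!: has_contour_integral_integrable)
  have "I = contour_integral (linepath a b) f + contour_integral (linepath b c) f
      + contour_integral (linepath c d) f + contour_integral (linepath d a) f"
    using contour_integral_unique[OF *] int by (simp add: add_ac)
  with int that show ?thesis
    using has_contour_integral_integral by blast
qed

text \<open>
  The rectangles to the right and to the left of the imaginary axis share the side on it, and the
  integrals over the other sides vanish in the limit. So only the jump \<open>f / \<Prod>(\<cdot> - p) - g(-\<cdot>)\<close> across
  the axis contributes.
\<close>

lemma half_plane_jump_bound:
  fixes f g :: "complex \<Rightarrow> complex" and B :: "real \<Rightarrow> real"
  assumes f: "continuous_on {z. Re z \<ge> 0} f" "f holomorphic_on {z. Re z > 0}"
    and g: "continuous_on {z. Re z \<ge> 0} g" "g holomorphic_on {z. Re z > 0}"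
    and P: "finite P" "\<And>p. p \<in> P \<Longrightarrow> Re p > 0"
    and z: "Re z > 0" "z \<notin> P"
    and lim_f: "((\<lambda>w. f w / (\<Prod>p\<in>P. w - p)) \<longlongrightarrow> 1) right_at_infinity"
    and lim_g: "(g \<longlongrightarrow> 1) right_at_infinity"
    and jump: "\<And>y. norm (f (\<i> * of_real y) / (\<Prod>p\<in>P. \<i> * of_real y - p) - g (- (\<i> * of_real y))) \<le> B y"
    and B: "\<And>R. B integrable_on {-R..R}" "\<And>R. R > 0 \<Longrightarrow> integral {-R..R} B \<le> J"
  shows "norm (f z / (\<Prod>p\<in>P. z - p) + (\<Sum>p\<in>P. f p / ((p - z) * (\<Prod>p'\<in>P - {p}. p - p'))) - 1)
           \<le> J / (2 * pi * Re z)"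
proof -
  define X where "X = f z / (\<Prod>p\<in>P. z - p) + (\<Sum>p\<in>P. f p / ((p - z) * (\<Prod>p'\<in>P - {p}. p - p'))) - 1"
  define \<Phi> where "\<Phi> = (\<lambda>w. f w / (\<Prod>p\<in>P. w - p))"
  have "2 * pi * norm X \<le> J / Re z + \<epsilon>" if "\<epsilon> > 0" for \<epsilon>
  proof -
    \<comment> \<open>Six outer sides with at most \<open>4 * e\<close> each add up to
      \<open>\<epsilon>\<close>.\<close>
    define e where "e = \<epsilon> / 24"
    have e: "e > 0" using that by (simp add: e_def)
    have "\<forall>\<^sub>F w in right_at_infinity. norm (\<Phi> w - 1) < e" "\<forall>\<^sub>F w in right_at_infinity. norm (g w - 1) < e"
      using tendstoD[OF lim_f e] tendstoD[OF lim_g e] by (simp_all add: dist_norm \<Phi>_def)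
    then obtain R1 R2 where
      R1: "\<And>w. Re w \<ge> 0 \<Longrightarrow> norm w \<ge> R1 \<Longrightarrow> norm (\<Phi> w - 1) < e" and
      R2: "\<And>w. Re w \<ge> 0 \<Longrightarrow> norm w \<ge> R2 \<Longrightarrow> norm (g w - 1) < e"
      unfolding eventually_right_at_infinity by blast
    obtain R3 where R3: "\<And>p. p \<in> P \<Longrightarrow> norm p \<le> R3"
      using finite_imp_bounded[OF P(1)] unfolding bounded_iff by blast
    define R where "R = Max {R1, R2, R3 + 1, 2 * norm z + 1}"
    have R: "R \<ge> R1" "R \<ge> R2" "R > R3" "R > 2 * norm z" "R > 0"
    proof -
      have "R1 \<le> R" "R2 \<le> R" "R3 + 1 \<le> R" "2 * norm z + 1 \<le> R"
        unfolding R_def by (rule Max_ge; simp)+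
      thus "R \<ge> R1" "R \<ge> R2" "R > R3" "R > 2 * norm z" "R > 0"
        using norm_ge_zero[of z] by linarith+
    qed
    define A where "A = (\<lambda>w. (\<Phi> w - 1) / (w - z))"
    define A' where "A' = (\<lambda>w. (g (- w) - 1) / (w - z))"
    have far: "norm (w - z) \<ge> R / 2" if "norm w \<ge> R" for w
      using norm_triangle_ineq2[of w z] R that by linarith
    \<comment> \<open>On an outer side the numerator is below \<open>e\<close>, the kernel is at
      most \<open>2 / R\<close> and the length at most \<open>2 * R\<close>, so the bound does not
      depend on \<open>R\<close>.\<close>
    have side: "norm I \<le> 4 * e"
      if int: "(h has_contour_integral I) (linepath x y)" and len: "norm (y - x) \<le> 2 * R"
        and bd: "\<And>w. w \<in> closed_segment x y \<Longrightarrow> norm w \<ge> R \<and> (\<exists>u. norm u < e \<and> h w = u / (w - z))"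
      for h I x y
    proof -
      have "norm I \<le> (2 * e / R) * norm (y - x)"
      proof (rule has_contour_integral_bound_linepath[OF int])
        show "0 \<le> 2 * e / R" using e R by simp
        fix w assume w: "w \<in> closed_segment x y"
        with bd obtain u where u: "norm w \<ge> R" "norm u < e" "h w = u / (w - z)" by blast
        have "norm u / norm (w - z) \<le> e / (R / 2)"
          using far[OF u(1)] u R e by (intro frac_le) auto
        thus "norm (h w) \<le> 2 * e / R" by (simp add: u norm_divide mult.commute)
      qed
      also have "\<dots> \<le> (2 * e / R) * (2 * R)"
        using len e R by (intro mult_left_mono) auto
      also have "\<dots> = 4 * e" using R by simp
      finally show ?thesis .
    qed
    have inside: "w \<in> box (Complex 0 (-R)) (Complex R R)" if "Re w > 0" "norm w < R" for w
      using that abs_Re_le_cmod[of w] abs_Im_le_cmod[of w] by (auto simp: in_box_complex_iff)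
    define Q where "Q = insert z P"
    have Qin: "Q \<subseteq> box (Complex 0 (-R)) (Complex R R)"
      unfolding Q_def using inside z P R3 R by fastforce
    have A: "(A has_contour_integral (2 * pi * \<i> * X)) (rectpath (Complex 0 (-R)) (Complex R R))"
    proof -
      \<comment> \<open>With \<open>z\<close> as one more simple pole, \<open>A\<close> is
        \<open>f1\<close> over the product for \<open>Q\<close>. Subtracting 1 changes no residue at
        \<open>P\<close>, as the subtracted product vanishes there, and it yields the
        \<open>- 1\<close> of \<open>X\<close> at \<open>z\<close>.\<close>
      define f1 where "f1 = (\<lambda>w. f w - (\<Prod>p\<in>P. w - p))"
      have sub: "cbox (Complex 0 (-R)) (Complex R R) \<subseteq> {z. Re z \<ge> 0}"
          "box (Complex 0 (-R)) (Complex R R) \<subseteq> {z. Re z > 0}"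
        by (auto simp: in_cbox_complex_iff in_box_complex_iff)
      have img: "path_image (rectpath (Complex 0 (-R)) (Complex R R)) \<subseteq>
          cbox (Complex 0 (-R)) (Complex R R) - Q"
        using Qin path_image_rectpath_cbox_minus_box[of "Complex 0 (-R)" "Complex R R"] R by auto
      have "((\<lambda>w. f1 w / (\<Prod>q\<in>Q. w - q)) has_contour_integral
           (2 * pi * \<i> * (\<Sum>q\<in>Q. f1 q / (\<Prod>q'\<in>Q - {q}. q - q')))) (rectpath (Complex 0 (-R)) (Complex R R))"
      proof (rule Cauchy_integral_formula_simple_poles)
        show "continuous_on (cbox (Complex 0 (-R)) (Complex R R)) f1"
          unfolding f1_def by (intro continuous_intros continuous_on_subset[OF f(1)] sub)
        show "f1 holomorphic_on interior (cbox (Complex 0 (-R)) (Complex R R))"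
          unfolding f1_def interior_cbox by (intro holomorphic_intros holomorphic_on_subset[OF f(2)] sub)
        show "path_image (rectpath (Complex 0 (-R)) (Complex R R)) \<subseteq>
          cbox (Complex 0 (-R)) (Complex R R) - Q" by (rule img)
      qed (use P Qin in \<open>auto simp: Q_def winding_number_rectpath\<close>)
      also have "(\<Sum>q\<in>Q. f1 q / (\<Prod>q'\<in>Q - {q}. q - q')) = X"
      proof -
        have "(\<Prod>q'\<in>Q - {p}. p - q') = (p - z) * (\<Prod>p'\<in>P - {p}. p - p')" if "p \<in> P" for p
        proof -
          have "Q - {p} = insert z (P - {p})" "z \<notin> P - {p}" using that z by (auto simp: Q_def)
          thus ?thesis using P by simp
        qed
        moreover have "f1 p = f p" if "p \<in> P" for p
          using that P by (auto simp: f1_def intro!: prod_zero)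
        ultimately have "(\<Sum>p\<in>P. f1 p / (\<Prod>q'\<in>Q - {p}. p - q')) =
            (\<Sum>p\<in>P. f p / ((p - z) * (\<Prod>p'\<in>P - {p}. p - p')))"
          by (intro sum.cong) auto
        moreover have "Q - {z} = P" using z by (auto simp: Q_def)
        moreover have "(\<Prod>p\<in>P. z - p) \<noteq> 0" using z P by auto
        hence "f1 z / (\<Prod>p\<in>P. z - p) = f z / (\<Prod>p\<in>P. z - p) - 1"
          by (simp add: f1_def diff_divide_distrib)
        ultimately show ?thesis using z P by (simp add: Q_def X_def)
      qed
      finally show ?thesis
      proof (rule has_contour_integral_eq)
        fix w assume "w \<in> path_image (rectpath (Complex 0 (-R)) (Complex R R))"
        hence w: "w \<notin> Q" using img by blast
        have "(\<Prod>p\<in>P. w - p) \<noteq> 0" using w P by (auto simp: Q_def)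
        moreover have "(\<Prod>q\<in>Q. w - q) = (w - z) * (\<Prod>p\<in>P. w - p)"
          using P z by (simp add: Q_def)
        moreover have "w - z \<noteq> 0" using w by (auto simp: Q_def)
        ultimately show "f1 w / (\<Prod>q\<in>Q. w - q) = A w"
          by (simp add: f1_def A_def \<Phi>_def field_simps)
      qed
    qed
    \<comment> \<open>The pole \<open>z\<close> of the kernel lies in the right half-plane, and
      \<open>g\<close> is evaluated at \<open>- w\<close>, so nothing is singular inside the left
      rectangle.\<close>
    have A': "(A' has_contour_integral 0) (rectpath (Complex (-R) (-R)) (Complex 0 R))"
    proof (rule Cauchy_theorem_convex)
      have sub: "uminus ` cbox (Complex (-R) (-R)) (Complex 0 R) \<subseteq> {z. Re z \<ge> 0}"
          "uminus ` box (Complex (-R) (-R)) (Complex 0 R) \<subseteq> {z. Re z > 0}"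
        by (auto simp: in_cbox_complex_iff in_box_complex_iff)
      have nz: "w - z \<noteq> 0" if "w \<in> cbox (Complex (-R) (-R)) (Complex 0 R)" for w
        using that z by (auto simp: in_cbox_complex_iff)
      show "continuous_on (cbox (Complex (-R) (-R)) (Complex 0 R)) A'"
        unfolding A'_def
        by (intro continuous_intros continuous_on_compose2[OF g(1) _ sub(1)]) (use nz in auto)
      have "A' holomorphic_on box (Complex (-R) (-R)) (Complex 0 R)"
        unfolding A'_def
        by (intro holomorphic_intros holomorphic_on_compose_gen[OF _ g(2), of uminus, unfolded o_def] sub(2))
           (use nz box_subset_cbox in auto)
      thus "A' field_differentiable at w"
        if "w \<in> interior (cbox (Complex (-R) (-R)) (Complex 0 R)) - {}" for w
        using that by (intro holomorphic_on_imp_differentiable_at) auto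
      show "path_image (rectpath (Complex (-R) (-R)) (Complex 0 R))
          \<subseteq> cbox (Complex (-R) (-R)) (Complex 0 R)"
        using R by (intro path_image_rectpath_subset_cbox) auto
    qed auto
    obtain I1 I2 I3 I4 where
      I: "(A has_contour_integral I1) (linepath (Complex 0 (-R)) (Complex R (-R)))"
         "(A has_contour_integral I2) (linepath (Complex R (-R)) (Complex R R))"
         "(A has_contour_integral I3) (linepath (Complex R R) (Complex 0 R))"
         "(A has_contour_integral I4) (linepath (Complex 0 R) (Complex 0 (-R)))"
         "2 * pi * \<i> * X = I1 + I2 + I3 + I4"
      using has_contour_integral_rectpath_sides[OF A refl refl, unfolded complex.sel] by blast
    obtain K1 K2 K3 K4 where
      K: "(A' has_contour_integral K1) (linepath (Complex (-R) (-R)) (Complex 0 (-R)))"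
         "(A' has_contour_integral K2) (linepath (Complex 0 (-R)) (Complex 0 R))"
         "(A' has_contour_integral K3) (linepath (Complex 0 R) (Complex (-R) R))"
         "(A' has_contour_integral K4) (linepath (Complex (-R) R) (Complex (-R) (-R)))"
         "0 = K1 + K2 + K3 + K4"
      using has_contour_integral_rectpath_sides[OF A' refl refl, unfolded complex.sel] by blast
    have seg_norm: "norm w \<ge> R" if "\<bar>Re w\<bar> = R \<or> \<bar>Im w\<bar> = R" for w
      using that abs_Re_le_cmod[of w] abs_Im_le_cmod[of w] by auto
    have bdA: "norm w \<ge> R \<and> (\<exists>u. norm u < e \<and> A w = u / (w - z))"
      if "\<bar>Re w\<bar> = R \<or> \<bar>Im w\<bar> = R" "Re w \<ge> 0" for w
      using R1[of w] seg_norm[of w] that R unfolding A_def by auto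
    have bdA': "norm w \<ge> R \<and> (\<exists>u. norm u < e \<and> A' w = u / (w - z))"
      if "\<bar>Re w\<bar> = R \<or> \<bar>Im w\<bar> = R" "Re w \<le> 0" for w
      using R2[of "- w"] seg_norm[of w] that R unfolding A'_def by auto
    have seg: "w \<in> closed_segment x y \<Longrightarrow> min (Re x) (Re y) \<le> Re w \<and> Re w \<le> max (Re x) (Re y)
        \<and> min (Im x) (Im y) \<le> Im w \<and> Im w \<le> max (Im x) (Im y)" for w x y
    proof -
      assume w: "w \<in> closed_segment x y"
      have "Re w \<in> closed_segment (Re x) (Re y)" "Im w \<in> closed_segment (Im x) (Im y)"
        using w closed_segment_linear_image[OF bounded_linear.linear[OF bounded_linear_Re], of x y]
          closed_segment_linear_image[OF bounded_linear.linear[OF bounded_linear_Im], of x y]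
        by auto
      thus ?thesis by (auto simp: closed_segment_eq_real_ivl split: if_splits)
    qed
    have len: "norm (Complex x y - Complex x' y') \<le> \<bar>x - x'\<bar> + \<bar>y - y'\<bar>" for x y x' y'
      using cmod_le[of "Complex x y - Complex x' y'"] by simp
    have "norm I1 \<le> 4 * e"
    proof (rule side[OF I(1)])
      show "norm (Complex R (-R) - Complex 0 (-R)) \<le> 2 * R"
        using len[of R "-R" 0 "-R"] R by simp
      fix w assume "w \<in> closed_segment (Complex 0 (-R)) (Complex R (-R))"
      from seg[OF this] show "norm w \<ge> R \<and> (\<exists>u. norm u < e \<and> A w = u / (w - z))"
        using R by (intro bdA) auto
    qed
    moreover have "norm I2 \<le> 4 * e"
    proof (rule side[OF I(2)])
      show "norm (Complex R R - Complex R (-R)) \<le> 2 * R"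
        using len[of R R R "-R"] R by simp
      fix w assume "w \<in> closed_segment (Complex R (-R)) (Complex R R)"
      from seg[OF this] show "norm w \<ge> R \<and> (\<exists>u. norm u < e \<and> A w = u / (w - z))"
        using R by (intro bdA) auto
    qed
    moreover have "norm I3 \<le> 4 * e"
    proof (rule side[OF I(3)])
      show "norm (Complex 0 R - Complex R R) \<le> 2 * R"
        using len[of 0 R R R] R by simp
      fix w assume "w \<in> closed_segment (Complex R R) (Complex 0 R)"
      from seg[OF this] show "norm w \<ge> R \<and> (\<exists>u. norm u < e \<and> A w = u / (w - z))"
        using R by (intro bdA) auto
    qed
    moreover have "norm K1 \<le> 4 * e"
    proof (rule side[OF K(1)])
      show "norm (Complex 0 (-R) - Complex (-R) (-R)) \<le> 2 * R"
        using len[of 0 "-R" "-R" "-R"] R by simp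
      fix w assume "w \<in> closed_segment (Complex (-R) (-R)) (Complex 0 (-R))"
      from seg[OF this] show "norm w \<ge> R \<and> (\<exists>u. norm u < e \<and> A' w = u / (w - z))"
        using R by (intro bdA') auto
    qed
    moreover have "norm K3 \<le> 4 * e"
    proof (rule side[OF K(3)])
      show "norm (Complex (-R) R - Complex 0 R) \<le> 2 * R"
        using len[of "-R" R 0 R] R by simp
      fix w assume "w \<in> closed_segment (Complex 0 R) (Complex (-R) R)"
      from seg[OF this] show "norm w \<ge> R \<and> (\<exists>u. norm u < e \<and> A' w = u / (w - z))"
        using R by (intro bdA') auto
    qed
    moreover have "norm K4 \<le> 4 * e"
    proof (rule side[OF K(4)])
      show "norm (Complex (-R) (-R) - Complex (-R) R) \<le> 2 * R"
        using len[of "-R" "-R" "-R" R] R by simp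
      fix w assume "w \<in> closed_segment (Complex (-R) R) (Complex (-R) (-R))"
      from seg[OF this] show "norm w \<ge> R \<and> (\<exists>u. norm u < e \<and> A' w = u / (w - z))"
        using R by (intro bdA') auto
    qed
    moreover have "norm (K2 + I4) \<le> J / Re z"
    proof -
      \<comment> \<open>The two rectangles run through the common side in opposite directions, and
        the subtracted constants 1 cancel in \<open>A - A'\<close>.\<close>
      have "(A has_contour_integral - I4) (linepath (Complex 0 (-R)) (Complex 0 R))"
        by (rule has_contour_integral_reverse_linepath[OF I(4)])
      hence "((\<lambda>w. A w - A' w) has_contour_integral (- I4 - K2)) (linepath (Complex 0 (-R)) (Complex 0 R))"
        using K(2) by (rule has_contour_integral_diff)
      hence int: "((\<lambda>y. A (Complex 0 y) - A' (Complex 0 y)) has_integral (- \<i> * (- I4 - K2))) {-R..R}"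
        by (subst (asm) has_contour_integral_linepath_same_Re_iff[where c = 0 and a = "-R" and b = R]) (use R in auto)
      have "norm (- \<i> * (- I4 - K2)) \<le> integral {-R..R} (\<lambda>y. B y / Re z)"
        unfolding integral_unique[OF int, symmetric]
      proof (rule integral_norm_bound_integral)
        show "(\<lambda>y. A (Complex 0 y) - A' (Complex 0 y)) integrable_on {-R..R}"
          using int by blast
        show "(\<lambda>y. B y / Re z) integrable_on {-R..R}"
          using B(1) by (intro integrable_on_divide)
        fix y
        have eq: "Complex 0 y = \<i> * of_real y" by (simp add: complex_eq_iff)
        have "norm (Complex 0 y - z) \<ge> Re z"
          using abs_Re_le_cmod[of "Complex 0 y - z"] by simp
        moreover have "A (Complex 0 y) - A' (Complex 0 y)
            = (\<Phi> (Complex 0 y) - g (- Complex 0 y)) / (Complex 0 y - z)"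
          by (simp add: A_def A'_def diff_divide_distrib)
        moreover have "norm (\<Phi> (Complex 0 y) - g (- Complex 0 y)) \<le> B y"
          using jump[of y] unfolding eq \<Phi>_def .
        ultimately show "norm (A (Complex 0 y) - A' (Complex 0 y)) \<le> B y / Re z"
          using z by (simp add: norm_divide) (intro frac_le; auto intro: order_trans[OF norm_ge_zero])
      qed
      also have "\<dots> = integral {-R..R} B / Re z" by (rule integral_divide)
      also have "\<dots> \<le> J / Re z" using B(2)[OF R(5)] z by (intro divide_right_mono) auto
      also have "norm (- \<i> * (- I4 - K2)) = norm (K2 + I4)"
        by (simp add: norm_mult) (metis add.commute minus_add_distrib norm_minus_cancel uminus_add_conv_diff)
      finally show ?thesis .
    qed
    moreover have "2 * pi * norm X = norm (I1 + I2 + I3 + K1 + K3 + K4 + (K2 + I4))"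
    proof -
      have "2 * pi * norm X = norm (2 * pi * \<i> * X)" by (simp add: norm_mult)
      also have "2 * pi * \<i> * X = (I1 + I2 + I3 + I4) + (K1 + K2 + K3 + K4)"
        using I(5) K(5) by simp
      also have "\<dots> = I1 + I2 + I3 + K1 + K3 + K4 + (K2 + I4)" by (simp add: add_ac)
      finally show ?thesis .
    qed
    moreover have "norm (I1 + I2 + I3 + K1 + K3 + K4 + (K2 + I4))
        \<le> norm I1 + norm I2 + norm I3 + norm K1 + norm K3 + norm K4 + norm (K2 + I4)"
      by (intro norm_triangle_le add_right_mono) simp
    ultimately show ?thesis by (simp add: e_def)
  qed
  hence "2 * pi * norm X \<le> J / Re z" by (rule field_le_epsilon)
  thus ?thesis using z unfolding X_def[symmetric] by (simp add: field_simps)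
qed


subsection \<open>The reciprocal of Stirling's ratio on the imaginary axis\<close>

text \<open>The principal power of \<open>z\<close> with exponent \<open>c + d * z\<close>; for
  \<open>c > 0\<close> the value 0 at the origin is its limit. The slope is \<open>d = 1\<close> for
  \<open>g\<close> and \<open>d = -1\<close> for \<open>F\<close>.\<close>

definition power_kernel :: "real \<Rightarrow> complex \<Rightarrow> complex \<Rightarrow> complex" where
  "power_kernel c d z = (if z = 0 then 0 else exp ((of_real c + d * z) * Ln z))"

lemma norm_power_kernel_le:
  assumes "z \<noteq> 0"
  shows "norm (power_kernel c d z) \<le> exp (c * ln (norm z) + norm d * norm z * (\<bar>ln (norm z)\<bar> + pi))"
proof -
  have "norm (Ln z) \<le> \<bar>Re (Ln z)\<bar> + \<bar>Im (Ln z)\<bar>" by (rule cmod_le)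
  also have "\<dots> \<le> \<bar>ln (norm z)\<bar> + pi"
    using assms mpi_less_Im_Ln[of z] Im_Ln_le_pi[of z] by simp
  finally have "norm (d * z * Ln z) \<le> norm d * norm z * (\<bar>ln (norm z)\<bar> + pi)"
    unfolding norm_mult by (intro mult_left_mono) auto
  moreover have "Re ((of_real c + d * z) * Ln z) = c * ln (norm z) + Re (d * z * Ln z)"
    using assms by (simp add: algebra_simps)
  ultimately show ?thesis
    using assms complex_Re_le_cmod[of "d * z * Ln z"] by (simp add: power_kernel_def)
qed

text \<open>Near the origin \<open>c * ln (norm z)\<close> tends to minus infinity, while the
  contribution of \<open>d * z\<close> tends to 0 because \<open>x * ln x\<close> does.\<close>

lemma power_kernel_tendsto_0:
  assumes "c > 0"
  shows "(power_kernel c d \<longlongrightarrow> 0) (at 0)"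
proof -
  define D where "D = norm d"
  have "filterlim norm (at_right 0) (at (0::complex))"
    unfolding filterlim_at by (auto intro!: tendsto_eq_intros simp: eventually_at intro: exI[of _ 1])
  moreover have "((\<lambda>x. exp (c * ln x + D * x * (\<bar>ln x\<bar> + pi))) \<longlongrightarrow> 0) (at_right 0)"
    using assms by real_asymp
  ultimately have "((\<lambda>z::complex. exp (c * ln (norm z) + D * norm z * (\<bar>ln (norm z)\<bar> + pi))) \<longlongrightarrow> 0) (at 0)"
    by (rule filterlim_compose[rotated])
  moreover have "\<forall>\<^sub>F z in at 0. norm (power_kernel c d z) \<le>
      exp (c * ln (norm z) + D * norm z * (\<bar>ln (norm z)\<bar> + pi))"
    unfolding D_def using norm_power_kernel_le by (auto simp: eventually_at intro: exI[of _ 1])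
  ultimately show ?thesis by (rule Lim_null_comparison[rotated])
qed

lemma not_nonpos_Real_Re_nonneg: "Re z \<ge> 0 \<Longrightarrow> z \<noteq> 0 \<Longrightarrow> z \<notin> \<real>\<^sub>\<le>\<^sub>0"
  by (auto simp: complex_nonpos_Reals_iff complex_eq_iff)

lemma continuous_on_power_kernel:
  assumes "c > 0"
  shows "continuous_on {z. Re z \<ge> 0} (power_kernel c d)"
  unfolding continuous_on_def
proof
  fix z :: complex assume z: "z \<in> {z. Re z \<ge> 0}"
  have "(power_kernel c d \<longlongrightarrow> power_kernel c d z) (at z)"
  proof (cases "z = 0")
    case True
    thus ?thesis using power_kernel_tendsto_0[OF assms, of d] by (simp add: power_kernel_def)
  next
    case False
    have "((\<lambda>z. exp ((of_real c + d * z) * Ln z)) \<longlongrightarrow> exp ((of_real c + d * z) * Ln z)) (at z)"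
      using z False not_nonpos_Real_Re_nonneg[of z] by (intro tendsto_intros) auto
    moreover have "\<forall>\<^sub>F w in at z. exp ((of_real c + d * w) * Ln w) = power_kernel c d w"
      using eventually_neq_at_within[of 0 z UNIV] by eventually_elim (simp add: power_kernel_def)
    ultimately show ?thesis using False by (auto simp: power_kernel_def elim: Lim_transform_eventually)
  qed
  thus "(power_kernel c d \<longlongrightarrow> power_kernel c d z) (at z within {z. Re z \<ge> 0})"
    by (rule tendsto_within_subset) simp
qed

lemma holomorphic_on_power_kernel:
  "power_kernel c d holomorphic_on {z. Re z > 0}"
proof (rule holomorphic_transform)
  show "(\<lambda>z. exp ((of_real c + d * z) * Ln z)) holomorphic_on {z. Re z > 0}"
    by (intro holomorphic_intros) (auto simp: complex_nonpos_Reals_iff)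
qed (auto simp: power_kernel_def)

text \<open>Normalised as \<open>norm (Gamma (a + \<i> * y)) / Gamma a\<close>, the modulus does not
  decrease with \<open>a\<close>: in the product for Gamma it consists of the factors
  \<open>1 / norm (1 + \<i> * y / (a + k))\<close>. The comparison is with 1 because the modulus has
  a closed form there. The numerators of the Gamma series agree since the real parts on either side
  sum to \<open>a + 1\<close>.\<close>

lemma norm_Gamma_vertical_mono:
  fixes a y :: real
  assumes "a \<ge> 1"
  shows "Gamma a * norm (Gamma (1 + \<i> * of_real y)) \<le> norm (Gamma (of_real a + \<i> * of_real y))"
proof -
  define u v :: complex where "u = of_real a + \<i> * of_real y" and "v = 1 + \<i> * of_real y"
  have step: "norm (u + of_nat k) * norm (1 + of_nat k :: complex)
      \<le> norm (of_real a + of_nat k :: complex) * norm (v + of_nat k)" for k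
  proof (rule power2_le_imp_le)
    have "a + real k \<ge> 1 + real k" using assms by simp
    hence "(1 + real k)\<^sup>2 * y\<^sup>2 \<le> (a + real k)\<^sup>2 * y\<^sup>2"
      by (intro mult_right_mono power_mono) auto
    thus "(norm (u + of_nat k) * norm (1 + of_nat k :: complex))\<^sup>2
      \<le> (norm (of_real a + of_nat k :: complex) * norm (v + of_nat k))\<^sup>2"
      unfolding power_mult_distrib cmod_power2 u_def v_def
      by (simp add: algebra_simps)
  qed auto
  have "norm (Gamma_series (of_real a :: complex) n) * norm (Gamma_series v n)
      \<le> norm (Gamma_series u n) * norm (Gamma_series (1 :: complex) n)" for n
  proof -
    have nz: "norm (pochhammer z (Suc n)) > 0" if "Re z > 0" for z :: complex
      using that by (auto simp: pochhammer_eq_0_iff)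
    have "norm (pochhammer u (Suc n)) * norm (pochhammer (1 :: complex) (Suc n))
        \<le> norm (pochhammer (of_real a :: complex) (Suc n)) * norm (pochhammer v (Suc n))"
      unfolding pochhammer_prod prod_norm[symmetric] prod.distrib[symmetric]
      by (intro prod_mono) (use step in auto)
    moreover have "Re u > 0" "Re v > 0" "Re (of_real a) > 0" "Re 1 > 0"
      using assms by (auto simp: u_def v_def)
    hence "norm (pochhammer u (Suc n)) > 0" "norm (pochhammer (1 :: complex) (Suc n)) > 0"
        "norm (pochhammer (of_real a :: complex) (Suc n)) > 0" "norm (pochhammer v (Suc n)) > 0"
      by (auto intro!: nz simp del: zero_less_norm_iff)
    moreover have "A / p * (B / q) \<le> C / r * (D / s)"
      if "A * B = C * D" "C \<ge> 0" "D \<ge> 0" "r * s \<le> p * q" "r > 0" "s > 0" "p > 0" "q > 0"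
      for A B C D p q r s :: real
      using that frac_le[of "C * D" "C * D" "r * s" "p * q"] by simp
    moreover have "norm (Gamma_series w n) = fact n * exp (Re w * ln n) / norm (pochhammer w (Suc n))"
      for w :: complex
      unfolding Gamma_series_def norm_divide norm_mult Suc_eq_plus1[symmetric] norm_exp_eq_Re by simp
    ultimately show ?thesis
      by (simp add: u_def v_def)
  qed
  moreover have "(\<lambda>n. norm (Gamma_series (of_real a :: complex) n) * norm (Gamma_series v n)) \<longlonglongrightarrow>
      norm (Gamma (of_real a :: complex)) * norm (Gamma v)"
    by (intro tendsto_intros)
  moreover have "(\<lambda>n. norm (Gamma_series u n) * norm (Gamma_series (1 :: complex) n)) \<longlonglongrightarrow>
      norm (Gamma u) * norm (Gamma (1 :: complex))"
    by (intro tendsto_intros)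
  ultimately have "norm (Gamma (of_real a :: complex)) * norm (Gamma v)
      \<le> norm (Gamma u) * norm (Gamma (1 :: complex))"
    by (blast intro: LIMSEQ_le)
  moreover have "norm (Gamma (of_real a :: complex)) = Gamma a"
    using assms Gamma_real_pos[of a] by (simp add: Gamma_complex_of_real)
  ultimately show ?thesis by (simp add: u_def v_def)
qed

lemma norm_Gamma_one_imaginary:
  assumes "y > 0"
  shows "(norm (Gamma (1 + \<i> * of_real y)))\<^sup>2 = pi * y / sinh (pi * y)"
proof -
  define z where "z = \<i> * of_real y"
  have z: "z \<noteq> 0" "z \<notin> \<int>\<^sub>\<le>\<^sub>0"
    using assms not_nonpos_Int_Re_nonneg[of z] by (auto simp: z_def)
  have "cnj z = - z" by (simp add: z_def)
  hence "of_real ((norm (Gamma z))\<^sup>2) = Gamma z * Gamma (- z)"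
    unfolding complex_norm_square by (simp add: cnj_Gamma)
  also have "\<dots> = - of_real pi / (z * sin (of_real pi * z))"
    by (rule Gamma_reflection_complex')
  also have "of_real pi * z = \<i> * of_real (pi * y)"
    by (simp add: z_def)
  also have "sin (\<i> * of_real (pi * y)) = \<i> * of_real (sinh (pi * y))"
    unfolding sin_i_times by (simp add: sinh_field_def flip: exp_minus exp_of_real)
  also have "z * (\<i> * of_real (sinh (pi * y))) = - of_real (y * sinh (pi * y))"
    by (simp add: z_def complex_eq_iff)
  also have "- of_real pi / (- of_real (y * sinh (pi * y))) = complex_of_real (pi / (y * sinh (pi * y)))"
    by simp
  finally have "(norm (Gamma z))\<^sup>2 = pi / (y * sinh (pi * y))"
    unfolding of_real_eq_iff .
  moreover have "Gamma (1 + z) = z * Gamma z"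
    using Gamma_plus1[of z] z by (simp add: add.commute)
  hence "(norm (Gamma (1 + z)))\<^sup>2 = y\<^sup>2 * (norm (Gamma z))\<^sup>2"
    by (simp add: norm_mult power_mult_distrib) (simp add: z_def norm_mult)
  ultimately have "(norm (Gamma (1 + z)))\<^sup>2 = y\<^sup>2 * (pi / (y * sinh (pi * y)))" by simp
  thus ?thesis
    using assms by (simp add: z_def power2_eq_square)
qed

text \<open>At \<open>a = 1\<close> the squared modulus is \<open>pi * y / sinh (pi * y)\<close>,
  which \<open>sinh x \<le> exp x / 2\<close> bounds below by
  \<open>2 * pi * y * exp (- (pi * y))\<close>. Other \<open>a\<close> follow by comparison.\<close>

lemma norm_Gamma_vertical_ge:
  fixes a y :: real
  assumes "a \<ge> 1" "y > 0"
  shows "Gamma a * sqrt (2 * pi * y) \<le> norm (Gamma (of_real a + \<i> * of_real y)) * exp (pi * y / 2)"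
proof -
  have "sqrt (2 * pi * y) \<le> norm (Gamma (1 + \<i> * of_real y)) * exp (pi * y / 2)"
  proof (rule power2_le_imp_le)
    have sinh: "sinh (pi * y) > 0" "sinh (pi * y) \<le> exp (pi * y) / 2"
      using assms by (auto simp: sinh_field_def)
    have "2 * pi * y = pi * y / (exp (pi * y) / 2) * exp (pi * y)" by simp
    also have "\<dots> \<le> pi * y / sinh (pi * y) * exp (pi * y)"
      using assms sinh by (intro mult_right_mono divide_left_mono) auto
    also have "\<dots> = (norm (Gamma (1 + \<i> * of_real y)) * exp (pi * y / 2))\<^sup>2"
      unfolding power_mult_distrib norm_Gamma_one_imaginary[OF assms(2)] exp_double[symmetric] by simp
    finally show "(sqrt (2 * pi * y))\<^sup>2 \<le> (norm (Gamma (1 + \<i> * of_real y)) * exp (pi * y / 2))\<^sup>2"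
      using assms by simp
  qed auto
  hence "Gamma a * sqrt (2 * pi * y) \<le> Gamma a * (norm (Gamma (1 + \<i> * of_real y)) * exp (pi * y / 2))"
    using assms Gamma_real_pos[of a] by (intro mult_left_mono) auto
  also have "\<dots> \<le> norm (Gamma (of_real a + \<i> * of_real y)) * exp (pi * y / 2)"
    unfolding mult.assoc[symmetric] using norm_Gamma_vertical_mono[OF assms(1)] by (intro mult_right_mono) auto
  finally show ?thesis .
qed

text \<open>The function \<open>g\<close>. In terms of \<open>rGamma\<close> and
  \<open>power_kernel\<close> it involves no division and takes the value 0 at the origin, which
  makes it continuous on the closed half-plane for \<open>a > 1/2\<close>.\<close>

definition inverse_stirling_ratio :: "real \<Rightarrow> complex \<Rightarrow> complex" where
  "inverse_stirling_ratio a z =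
     of_real (sqrt (2 * pi)) * exp (- z) * power_kernel (a - 1/2) 1 z * rGamma (z + of_real a)"

lemma inverse_stirling_ratio_eq:
  "z \<noteq> 0 \<Longrightarrow> inverse_stirling_ratio a z = inverse (stirling_ratio a z)"
proof -
  assume z: "z \<noteq> 0"
  have "exp (- z) * exp ((of_real (a - 1/2) + 1 * z) * Ln z) = exp (- ((1/2 - of_real a - z) * Ln z + z))"
    unfolding exp_add[symmetric] by (rule arg_cong[of _ _ exp]) (simp add: algebra_simps)
  with z have "inverse_stirling_ratio a z = of_real (sqrt (2 * pi))
      * exp (- ((1/2 - of_real a - z) * Ln z + z)) * rGamma (z + of_real a)"
    by (simp add: inverse_stirling_ratio_def power_kernel_def)
  also have "\<dots> = of_real (sqrt (2 * pi)) * inverse (exp ((1/2 - of_real a - z) * Ln z + z))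
      * inverse (Gamma (z + of_real a))"
    by (simp only: exp_minus rGamma_inverse_Gamma)
  also have "r * inverse e * inverse G = inverse (G * e / r)" for r e G :: complex
    by (simp add: divide_inverse mult_ac)
  finally show ?thesis
    unfolding stirling_ratio_def .
qed

lemma inverse_stirling_ratio_tendsto:
  assumes "a \<ge> 0"
  shows "(inverse_stirling_ratio a \<longlongrightarrow> 1) right_at_infinity"
proof -
  have "((\<lambda>z. inverse (stirling_ratio a z)) \<longlongrightarrow> inverse 1) right_at_infinity"
    by (intro tendsto_inverse stirling_ratio_tendsto_1 assms) simp
  hence "((\<lambda>z. inverse (stirling_ratio a z)) \<longlongrightarrow> 1) right_at_infinity" by simp
  moreover have "\<forall>\<^sub>F z in right_at_infinity. inverse (stirling_ratio a z) = inverse_stirling_ratio a z"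
    by (rule eventually_right_at_infinityI[of 1]) (subst inverse_stirling_ratio_eq, auto)
  ultimately show ?thesis by (rule Lim_transform_eventually)
qed

lemma continuous_on_inverse_stirling_ratio:
  "a > 1/2 \<Longrightarrow> continuous_on {z. Re z \<ge> 0} (inverse_stirling_ratio a)"
  unfolding inverse_stirling_ratio_def
  by (intro continuous_intros continuous_on_power_kernel
      continuous_on_compose2[OF holomorphic_on_imp_continuous_on[OF holomorphic_rGamma[of UNIV]]]) auto

lemma holomorphic_on_inverse_stirling_ratio:
  "inverse_stirling_ratio a holomorphic_on {z. Re z > 0}"
  unfolding inverse_stirling_ratio_def
  by (intro holomorphic_intros holomorphic_on_power_kernel)

lemma cnj_inverse_stirling_ratio:
  assumes "Re z \<ge> 0"
  shows "inverse_stirling_ratio a (cnj z) = cnj (inverse_stirling_ratio a z)"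
  using cnj_Ln[OF not_nonpos_Real_Re_nonneg[OF assms]]
  by (simp add: inverse_stirling_ratio_def power_kernel_def exp_cnj cnj_rGamma)

text \<open>The decay \<open>exp (- (pi * y / 2))\<close> of the power cancels against that of
  Gamma, leaving only powers of \<open>y\<close>. Their growth is harmless: the jump carries a
  further exponential factor, and its integral produces a \<open>Gamma a\<close> that cancels the
  denominator. For \<open>a = 1\<close> the bound is 1 away from the origin.\<close>

lemma norm_inverse_stirling_ratio_imaginary:
  assumes "a \<ge> 1"
  shows "norm (inverse_stirling_ratio a (\<i> * of_real y)) \<le> \<bar>y\<bar> powr (a - 1) / Gamma a"
proof -
  have pos: "norm (inverse_stirling_ratio a (\<i> * of_real y)) \<le> \<bar>y\<bar> powr (a - 1) / Gamma a"
    if y: "y > 0" for y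
  proof -
    define G where "G = norm (Gamma (of_real a + \<i> * of_real y))"
    have a: "Gamma a > 0" using assms by (intro Gamma_real_pos) auto
    have "Gamma a * sqrt (2 * pi * y) > 0" using a y by simp
    hence G: "G > 0" "Gamma a * sqrt (2 * pi * y) \<le> G * exp (pi * y / 2)"
      using norm_Gamma_vertical_ge[OF assms y] unfolding G_def by (auto intro: gr0I simp: less_le)
    have pk: "norm (power_kernel (a - 1/2) 1 (\<i> * of_real y)) = y powr (a - 1/2) * exp (- (pi * y / 2))"
    proof -
      have "power_kernel (a - 1/2) 1 (\<i> * of_real y)
          = exp ((of_real (a - 1/2) + 1 * (\<i> * of_real y)) * (of_real (ln y) + \<i> * of_real (pi / 2)))"
        using y by (simp only: power_kernel_def Ln_imaginary[OF y]) simp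
      also have "norm \<dots> = exp ((a - 1/2) * ln y + - (pi * y / 2))"
        unfolding norm_exp_eq_Re by simp
      also have "\<dots> = y powr (a - 1/2) * exp (- (pi * y / 2))"
        using y by (simp only: exp_add powr_def) simp
      finally show ?thesis .
    qed
    have rG: "norm (rGamma (\<i> * of_real y + of_real a)) = 1 / G"
      by (simp only: rGamma_inverse_Gamma norm_inverse G_def inverse_eq_divide add.commute)
         (simp add: norm_divide)
    have "norm (inverse_stirling_ratio a (\<i> * of_real y))
        = sqrt (2 * pi) * (y powr (a - 1/2) * exp (- (pi * y / 2))) / G"
      unfolding inverse_stirling_ratio_def norm_mult pk rG by simp
    also have "\<dots> = sqrt (2 * pi) * y powr (a - 1/2) / (G * exp (pi * y / 2))"
      by (simp add: exp_minus field_simps)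
    also have "\<dots> \<le> sqrt (2 * pi) * y powr (a - 1/2) / (Gamma a * sqrt (2 * pi * y))"
      using G a y by (intro divide_left_mono mult_pos_pos) auto
    also have "y powr (a - 1/2) = y powr (a - 1) * sqrt y"
      using powr_add[of y "a - 1" "1/2"] y powr_half_sqrt[of y] by (simp add: field_simps)
    also have "sqrt (2 * pi) * (y powr (a - 1) * sqrt y) / (Gamma a * sqrt (2 * pi * y)) = y powr (a - 1) / Gamma a"
      using y a by (simp add: real_sqrt_mult)
    finally show ?thesis using y by simp
  qed
  consider "y > 0" | "y = 0" | "y < 0" by linarith
  thus ?thesis
  proof cases
    case 3
    have "inverse_stirling_ratio a (\<i> * of_real y) = cnj (inverse_stirling_ratio a (\<i> * of_real (- y)))"
      using cnj_inverse_stirling_ratio[of "\<i> * of_real (- y)" a] by simp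
    thus ?thesis using pos[of "- y"] 3 by simp
  qed (use pos in \<open>auto simp: inverse_stirling_ratio_def power_kernel_def\<close>)
qed


subsection \<open>Spouge's approximation for scalars\<close>

lemma tendsto_divide_add_const:
  "((\<lambda>z. z / (z + c)) \<longlongrightarrow> 1) right_at_infinity"
proof -
  have "((\<lambda>z::complex. c * inverse z) \<longlongrightarrow> c * 0) right_at_infinity"
    unfolding right_at_infinity_def
    by (intro tendsto_mult tendsto_const tendsto_mono[OF inf_le1 tendsto_inverse_0])
  hence "((\<lambda>z::complex. inverse (1 + c * inverse z)) \<longlongrightarrow> inverse (1 + c * 0)) right_at_infinity"
    by (rule tendsto_inverse[OF tendsto_add[OF tendsto_const]]) simp
  moreover have "\<forall>\<^sub>F z in right_at_infinity. inverse (1 + c * inverse z) = z / (z + c)"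
  proof (rule eventually_right_at_infinityI)
    fix z :: complex assume z: "norm z \<ge> norm c + 1"
    have "z + c \<noteq> 0"
    proof
      assume "z + c = 0"
      hence "norm z = norm c" by (metis add_eq_0_iff2 norm_minus_cancel)
      with z show False by simp
    qed
    moreover have "z \<noteq> 0" using z norm_ge_zero[of c] by (auto simp del: norm_ge_zero)
    ultimately show "inverse (1 + c * inverse z) = z / (z + c)" by (simp add: field_simps)
  qed
  ultimately show ?thesis by (auto elim: Lim_transform_eventually)
qed

lemma stirling_ratio_Suc:
  assumes "Re z \<ge> 0" "norm z > \<bar>b\<bar>"
  shows "stirling_ratio b z = stirling_ratio (b + 1) z * (z / (z + of_real b))"
proof -
  have z: "z \<noteq> 0" using assms by auto
  \<comment> \<open>If \<open>z + b = - j\<close>, then \<open>z = - b - j\<close> would be real and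
    nonnegative, hence of modulus at most \<open>|b|\<close>.\<close>
  have "z + of_real b \<notin> \<int>\<^sub>\<le>\<^sub>0"
  proof
    assume "z + of_real b \<in> \<int>\<^sub>\<le>\<^sub>0"
    then obtain j :: nat where j: "z + of_real b = - of_nat j" by (auto elim!: nonpos_Ints_cases')
    have "z = (z + of_real b) - of_real b" by simp
    hence "z = of_real (- b - real j)" unfolding j by simp
    hence "norm z = \<bar>- b - real j\<bar>" "Re z = - b - real j" by (simp_all only: norm_of_real Re_complex_of_real)
    thus False using assms by linarith
  qed
  hence "Gamma (z + of_real b + 1) = (z + of_real b) * Gamma (z + of_real b)" "z + of_real b \<noteq> 0"
    by (auto simp: Gamma_plus1)
  moreover have "exp ((1/2 - of_real b - z) * Ln z + z) = exp ((1/2 - of_real (b + 1) - z) * Ln z + z) * z"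
  proof -
    have "exp ((1/2 - of_real b - z) * Ln z + z) = exp ((1/2 - of_real (b + 1) - z) * Ln z + z + Ln z)"
      by (rule arg_cong[of _ _ exp]) (simp add: algebra_simps)
    also have "\<dots> = exp ((1/2 - of_real (b + 1) - z) * Ln z + z) * exp (Ln z)" by (rule exp_add)
    finally show ?thesis using z by simp
  qed
  ultimately show ?thesis by (simp add: stirling_ratio_def add_ac)
qed

text \<open>The summation of increments assumed \<open>b \<ge> 0\<close>, but \<open>F\<close> has
  the negative shift \<open>1 - a\<close>. The functional equation lowers \<open>b\<close> by one at
  a time, at the price of a factor tending to 1.\<close>

lemma stirling_ratio_tendsto_1':
  "(stirling_ratio b \<longlongrightarrow> 1) right_at_infinity"
proof -
  have "(stirling_ratio b \<longlongrightarrow> 1) right_at_infinity" if "b \<ge> - real n" for n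
    using that
  proof (induction n arbitrary: b)
    case 0
    thus ?case by (intro stirling_ratio_tendsto_1) simp
  next
    case (Suc n)
    have "((\<lambda>z. stirling_ratio (b + 1) z * (z / (z + of_real b))) \<longlongrightarrow> 1 * 1) right_at_infinity"
      using Suc by (intro tendsto_mult tendsto_divide_add_const) auto
    moreover have "\<forall>\<^sub>F z in right_at_infinity.
        stirling_ratio (b + 1) z * (z / (z + of_real b)) = stirling_ratio b z"
      by (rule eventually_right_at_infinityI[of "\<bar>b\<bar> + 1"]) (rule stirling_ratio_Suc[symmetric], auto)
    ultimately show ?case by (auto elim: Lim_transform_eventually)
  qed
  from this[of "nat \<lceil>- b\<rceil>"] show ?thesis by linarith
qed

lemma spouge_terms_bounds:
  assumes "a > 0"
  shows "real (spouge_terms a) < a" "a \<le> real (spouge_terms a) + 1"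
  using assms unfolding spouge_terms_def by linarith+

text \<open>
  This is \<open>stirling_ratio (1 - a)\<close> with its poles in the right half-plane cleared. The last factor
  accounts for one pole more, so that \<open>Gamma\<close> is evaluated away from its poles also at \<open>z = 0\<close>;
  there \<open>0 / 0 = 0\<close> if \<open>a\<close> is an integer, which is the correct limit value of the product.
\<close>

definition spouge_regular :: "real \<Rightarrow> complex \<Rightarrow> complex" where
  "spouge_regular a z =
     (let b = of_real (real (spouge_terms a) + 2 - a) in
      Gamma (z + b) * exp z / of_real (sqrt (2 * pi)) * power_kernel (a - 3/2) (- 1) z * (z / (z + b - 1)))"

definition spouge_poles :: "real \<Rightarrow> complex set" where
  "spouge_poles a = (\<lambda>k. of_real (a - real k)) ` {1..spouge_terms a}"

lemma inj_spouge_pole: "inj_on (\<lambda>k. complex_of_real (a - real k)) A"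
  by (auto simp: inj_on_def simp del: of_real_diff)

lemma Re_spouge_poles:
  assumes "a > 0" "p \<in> spouge_poles a"
  shows "Re p > 0"
proof -
  obtain k where "p = of_real (a - real k)" "k \<le> spouge_terms a"
    using assms by (auto simp: spouge_poles_def)
  thus ?thesis using spouge_terms_bounds(1)[OF assms(1)] by simp
qed

lemma prod_spouge_poles:
  "(\<Prod>p\<in>spouge_poles a. z - p) = (\<Prod>k\<in>{1..spouge_terms a}. z - of_real (a - real k))"
  unfolding spouge_poles_def by (subst prod.reindex[OF inj_spouge_pole]) simp

lemma add_nonneg_real_eq_0:
  assumes "Re z \<ge> 0" "z + of_real c = 0" "c \<ge> 0"
  shows "z = 0"
  using assms by (auto simp: complex_eq_iff)

lemma continuous_on_spouge_regular:
  assumes "a \<ge> 3"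
  shows "continuous_on {z. Re z \<ge> 0} (spouge_regular a)"
proof -
  define b where "b = real (spouge_terms a) + 2 - a"
  have b: "b \<ge> 1" using spouge_terms_bounds[of a] assms by (simp add: b_def)
  define K where "K = (\<lambda>z. power_kernel (a - 3/2) (- 1) z * (z / (z + of_real b - 1)))"
  have nz: "z + of_real b - 1 \<noteq> 0" if "Re z \<ge> 0" "z \<noteq> 0" for z
    using add_nonneg_real_eq_0[of z "b - 1"] that b by (auto simp: algebra_simps)
  have "(K \<longlongrightarrow> K z) (at z within {z. Re z \<ge> 0})" if z: "Re z \<ge> 0" for z
  proof (cases "z = 0")
    case True
    \<comment> \<open>As \<open>b \<ge> 1\<close>, the quotient is bounded by 1 on the half-plane,
      also for an integer \<open>a\<close>, where \<open>b = 1\<close> and it equals 1 off the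
      origin. The kernel with \<open>a - 3/2 > 0\<close> then forces the limit 0.\<close>
    have "norm (K w) \<le> norm (power_kernel (a - 3/2) (- 1) w)" if "Re w \<ge> 0" for w
    proof -
      have "(norm w)\<^sup>2 \<le> (norm (w + of_real b - 1))\<^sup>2"
        unfolding cmod_power2 using that b by (simp add: power_mono)
      hence "norm w \<le> norm (w + of_real b - 1)"
        by (rule power2_le_imp_le) simp
      hence "norm (w / (w + of_real b - 1)) \<le> 1"
        by (simp add: norm_divide divide_le_eq_1)
      hence "norm (power_kernel (a - 3/2) (- 1) w) * norm (w / (w + of_real b - 1))
          \<le> norm (power_kernel (a - 3/2) (- 1) w) * 1"
        by (intro mult_left_mono) auto
      thus ?thesis unfolding K_def norm_mult by simp
    qed
    hence "\<forall>\<^sub>F w in at 0 within {z. Re z \<ge> 0}. norm (K w) \<le> norm (power_kernel (a - 3/2) (- 1) w)"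
      by (auto simp: eventually_at intro: exI[of _ 1])
    moreover have "((\<lambda>w. norm (power_kernel (a - 3/2) (- 1) w)) \<longlongrightarrow> 0) (at 0 within {z. Re z \<ge> 0})"
      using assms by (intro tendsto_norm_zero tendsto_within_subset[OF power_kernel_tendsto_0]) auto
    ultimately have "(K \<longlongrightarrow> 0) (at 0 within {z. Re z \<ge> 0})" by (rule Lim_null_comparison)
    thus ?thesis using True by (simp add: K_def power_kernel_def)
  next
    case False
    have "(power_kernel (a - 3/2) (- 1) \<longlongrightarrow> power_kernel (a - 3/2) (- 1) z) (at z within {z. Re z \<ge> 0})"
      using continuous_on_power_kernel[of "a - 3/2" "- 1"] z assms by (simp add: continuous_on_def)
    thus ?thesis unfolding K_def by (intro tendsto_intros nz z False)
  qed
  hence "continuous_on {z. Re z \<ge> 0} K" by (simp add: continuous_on_def)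
  moreover have "z + of_real b \<notin> \<int>\<^sub>\<le>\<^sub>0" if "Re z \<ge> 0" for z
    using that b by (intro not_nonpos_Int_Re_nonneg) (auto simp: complex_eq_iff)
  hence "continuous_on {z. Re z \<ge> 0} (\<lambda>z. Gamma (z + of_real b))"
    by (intro holomorphic_on_imp_continuous_on holomorphic_intros) auto
  ultimately have "continuous_on {z. Re z \<ge> 0} (\<lambda>z. Gamma (z + of_real b) * exp z / of_real (sqrt (2 * pi)) * K z)"
    by (intro continuous_intros) auto
  thus ?thesis by (simp add: spouge_regular_def K_def b_def Let_def mult.assoc)
qed

lemma holomorphic_on_spouge_regular:
  assumes "a \<ge> 3"
  shows "spouge_regular a holomorphic_on {z. Re z > 0}"
proof -
  define b where "b = real (spouge_terms a) + 2 - a"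
  have b: "b \<ge> 1" using spouge_terms_bounds[of a] assms by (simp add: b_def)
  have "z + of_real b - 1 \<noteq> 0" if "Re z > 0" for z
    using add_nonneg_real_eq_0[of z "b - 1"] that b by (auto simp: algebra_simps)
  moreover have "z + of_real b \<notin> \<int>\<^sub>\<le>\<^sub>0" if "Re z > 0" for z
    using that b by (intro not_nonpos_Int_Re_nonneg) (auto simp: complex_eq_iff)
  ultimately show ?thesis
    unfolding spouge_regular_def Let_def b_def[symmetric]
    by (intro holomorphic_intros holomorphic_on_power_kernel) auto
qed

text \<open>With \<open>s = z + 1 - a\<close> and \<open>m = spouge_terms a\<close>, Gamma at
  \<open>z + b\<close> is \<open>Gamma s\<close> times the product of
  \<open>s, s + 1, ..., s + m\<close>. The first \<open>m\<close> factors are the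
  \<open>z - p\<close>. The last one is \<open>z + b - 1\<close> and cancels against the correcting
  quotient, whose numerator \<open>z\<close> raises the exponent \<open>a - 3/2 - z\<close> to the
  required \<open>a - 1/2 - z\<close>.\<close>

lemma spouge_regular_divide:
  assumes "a \<ge> 3" "Re z \<ge> 0" "z \<noteq> 0" "z \<notin> spouge_poles a"
  shows "spouge_regular a z / (\<Prod>p\<in>spouge_poles a. z - p) = stirling_ratio (1 - a) z"
proof -
  define N where "N = spouge_terms a"
  define b where "b = real N + 2 - a"
  have b: "b \<ge> 1" using spouge_terms_bounds[of a] assms by (simp add: b_def N_def)
  define s where "s = z + of_real (1 - a)"
  \<comment> \<open>If \<open>s = - j\<close>, then \<open>z = a - (j + 1)\<close>, and a point of
    this form in the closed half-plane is either the origin or one of the poles.\<close>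
  have s: "s \<notin> \<int>\<^sub>\<le>\<^sub>0"
  proof
    assume "s \<in> \<int>\<^sub>\<le>\<^sub>0"
    then obtain j :: nat where j: "s = - of_nat j" by (auto elim!: nonpos_Ints_cases')
    have "z = s - of_real (1 - a)" by (simp add: s_def)
    hence zj: "z = of_real (a - real (Suc j))" unfolding j by simp
    hence "a - real (Suc j) \<ge> 0" using assms by simp
    moreover have "a - real (Suc j) \<noteq> 0" using assms zj by auto
    ultimately have "real (Suc j) < real N + 1"
      using spouge_terms_bounds(2)[of a] assms unfolding N_def by linarith
    hence "Suc j \<in> {1..N}" by auto
    hence "z \<in> spouge_poles a" unfolding zj spouge_poles_def N_def by blast
    with assms show False by simp
  qed
  have "pochhammer s (Suc N) = (\<Prod>p\<in>spouge_poles a. z - p) * (z + of_real b - 1)"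
  proof -
    have "pochhammer s (Suc N) = (\<Prod>i<N. s + of_nat i) * (s + of_nat N)"
      by (simp add: pochhammer_prod lessThan_atLeast0)
    also have "(\<Prod>i<N. s + of_nat i) = (\<Prod>p\<in>spouge_poles a. z - p)"
      unfolding prod_spouge_poles N_def[symmetric] One_nat_def prod.atLeast1_atMost_eq
      by (intro prod.cong) (auto simp: s_def algebra_simps)
    also have "s + of_nat N = z + of_real b - 1" by (simp add: s_def b_def)
    finally show ?thesis .
  qed
  moreover have "pochhammer s (Suc N) = Gamma (s + of_nat (Suc N)) / Gamma s"
    using s by (rule pochhammer_Gamma)
  moreover have "s + of_nat (Suc N) = z + of_real b" by (simp add: s_def b_def)
  moreover have Gs: "Gamma s \<noteq> 0" using s by (simp add: Gamma_eq_zero_iff)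
  ultimately have G: "Gamma (z + of_real b) = (\<Prod>p\<in>spouge_poles a. z - p) * (z + of_real b - 1) * Gamma s"
    by (simp add: field_simps)
  have prod_nz: "(\<Prod>p\<in>spouge_poles a. z - p) \<noteq> 0"
    using assms by (auto simp: spouge_poles_def)
  have nz: "z + of_real b - 1 \<noteq> 0"
    using add_nonneg_real_eq_0[of z "b - 1"] assms b by (auto simp: algebra_simps)
  have "power_kernel (a - 3/2) (- 1) z * z = exp ((of_real (a - 3/2) + - 1 * z) * Ln z + Ln z)"
    using assms by (simp add: power_kernel_def exp_add)
  also have "\<dots> = exp ((1/2 - of_real (1 - a) - z) * Ln z)"
    by (rule arg_cong[of _ _ exp]) (simp add: algebra_simps)
  finally have E: "power_kernel (a - 3/2) (- 1) z * z = exp ((1/2 - of_real (1 - a) - z) * Ln z)" .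
  have "spouge_regular a z = (\<Prod>p\<in>spouge_poles a. z - p) * Gamma s * exp z / of_real (sqrt (2 * pi))
      * (power_kernel (a - 3/2) (- 1) z * z)"
    unfolding spouge_regular_def Let_def N_def[symmetric] b_def[symmetric] G using nz by simp
  thus ?thesis
    using prod_nz unfolding E stirling_ratio_def s_def[symmetric] exp_add by simp
qed

lemma spouge_regular_divide_tendsto:
  assumes "a \<ge> 3"
  shows "((\<lambda>z. spouge_regular a z / (\<Prod>p\<in>spouge_poles a. z - p)) \<longlongrightarrow> 1) right_at_infinity"
proof (rule Lim_transform_eventually[OF stirling_ratio_tendsto_1'])
  have "norm p < a + 1" if p: "p \<in> spouge_poles a" for p
  proof -
    obtain k where "p = of_real (a - real k)" using p unfolding spouge_poles_def by blast
    moreover from this have "a - real k > 0" using Re_spouge_poles[of a p] p assms by simp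
    ultimately show ?thesis by (simp only: norm_of_real) 
  qed
  hence away: "z \<notin> spouge_poles a" if "norm z \<ge> a + 1" for z
    using that by force
  show "\<forall>\<^sub>F z in right_at_infinity.
      stirling_ratio (1 - a) z = spouge_regular a z / (\<Prod>p\<in>spouge_poles a. z - p)"
  proof (rule eventually_right_at_infinityI)
    fix z assume z: "Re z \<ge> 0" "norm z \<ge> a + 1"
    moreover have "z \<noteq> 0" using z assms by auto
    ultimately show "stirling_ratio (1 - a) z = spouge_regular a z / (\<Prod>p\<in>spouge_poles a. z - p)"
      using assms away by (intro spouge_regular_divide[symmetric]) auto
  qed
qed

section \<open>The jump across the imaginary axis\<close>

lemma cnj_stirling_ratio:
  assumes "Re z \<ge> 0" "z \<noteq> 0"
  shows "stirling_ratio b (cnj z) = cnj (stirling_ratio b z)"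
  using cnj_Ln[OF not_nonpos_Real_Re_nonneg[OF assms]]
  by (simp add: stirling_ratio_def exp_cnj cnj_Gamma)

lemma Ln_minus_imaginary:
  assumes "y > 0"
  shows "Ln (- (\<i> * of_real y)) = of_real (ln y) - \<i> * of_real (pi / 2)"
  using assms Ln_times_of_real[of y "- \<i>"] by (simp add: mult.commute Ln_of_real)

text \<open>The two Gamma arguments are \<open>1 - u\<close> and \<open>u\<close>, so the reflection
  formula links them. Both powers have the exponent \<open>c = u - 1/2\<close>, but the logarithms
  of \<open>\<i> * y\<close> and \<open>- \<i> * y\<close> differ by \<open>\<i> * pi\<close>; the
  resulting \<open>exp (\<i> * pi * c)\<close>, multiplied by
  \<open>1 - exp (- (2 * \<i> * pi * u))\<close>, is \<open>2 * sin (pi * u)\<close>.\<close>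

lemma stirling_ratio_reflection:
  fixes a y :: real
  assumes "y > 0"
  defines "u \<equiv> of_real a - \<i> * of_real y"
  shows "stirling_ratio (1 - a) (\<i> * of_real y) * (1 - exp (- (2 * \<i> * of_real pi * u)))
           = inverse_stirling_ratio a (- (\<i> * of_real y))"
proof -
  define c where "c = u - 1/2"
  define h where "h = \<i> * of_real (pi / 2)"
  have "1 - u \<notin> \<int>\<^sub>\<le>\<^sub>0" using assms by (auto elim!: nonpos_Ints_cases' simp: complex_eq_iff)
  hence "Gamma (1 - u) \<noteq> 0" by (simp add: Gamma_eq_zero_iff)
  hence rG: "rGamma u = Gamma (1 - u) * sin (of_real pi * u) / of_real pi"
    using rGamma_reflection_complex[of u]
    unfolding rGamma_inverse_Gamma[of "1 - u"] by (simp add: field_simps)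
  have F: "stirling_ratio (1 - a) (\<i> * of_real y)
      = Gamma (1 - u) * (exp (c * of_real (ln y)) * exp (c * h) * exp (\<i> * of_real y)) / of_real (sqrt (2 * pi))"
  proof -
    have "1/2 - of_real (1 - a) - \<i> * of_real y = c" by (simp add: c_def u_def)
    moreover have "\<i> * of_real y + of_real (1 - a) = 1 - u" by (simp add: u_def)
    ultimately show ?thesis
      unfolding stirling_ratio_def Ln_imaginary[OF assms(1)] h_def[symmetric]
      by (simp only: exp_add distrib_left)
  qed
  have g: "inverse_stirling_ratio a (- (\<i> * of_real y))
      = of_real (sqrt (2 * pi)) * exp (\<i> * of_real y) * (exp (c * of_real (ln y)) * exp (- (c * h))) * rGamma u"
  proof -
    have "of_real (a - 1/2) + 1 * - (\<i> * of_real y) = c" by (simp add: c_def u_def)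
    moreover have "- (\<i> * of_real y) + of_real a = u" by (simp add: u_def)
    moreover have "- (\<i> * complex_of_real y) \<noteq> 0" using assms by simp
    moreover have "exp (c * (of_real (ln y) - h)) = exp (c * of_real (ln y)) * exp (- (c * h))"
      unfolding exp_add[symmetric] by (rule arg_cong[of _ _ exp]) (simp add: algebra_simps)
    ultimately show ?thesis
      unfolding inverse_stirling_ratio_def power_kernel_def Ln_minus_imaginary[OF assms(1)] h_def[symmetric]
      by (simp only: if_False minus_minus)
  qed
  have key: "exp (c * h) * (1 - exp (- (2 * \<i> * of_real pi * u))) = 2 * sin (of_real pi * u) * exp (- (c * h))"
  proof -
    have e1: "exp (c * h) = exp (2 * (c * h)) * exp (- (c * h))"
      unfolding exp_add[symmetric] by simp
    have e2: "exp (2 * (c * h)) * (1 - exp (- (2 * \<i> * of_real pi * u))) = 2 * sin (of_real pi * u)"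
    proof -
      have "2 * (c * h) = \<i> * (of_real pi * u) - \<i> * of_real (pi / 2)"
        by (simp add: c_def h_def algebra_simps diff_divide_distrib)
      hence "exp (2 * (c * h)) = exp (\<i> * (of_real pi * u)) * exp (- (\<i> * of_real (pi / 2)))"
        by (simp only: diff_conv_add_uminus exp_add)
      moreover have "exp (- (\<i> * of_real (pi / 2))) = - \<i>"
        using exp_Euler[of "- of_real (pi / 2)"] by (simp add: cos_of_real sin_of_real del: of_real_divide)
      moreover have "exp (\<i> * (of_real pi * u)) * exp (- (2 * \<i> * of_real pi * u)) = exp (- (\<i> * (of_real pi * u)))"
        unfolding exp_add[symmetric] by (rule arg_cong[of _ _ exp]) (simp add: algebra_simps)
      moreover have "2 * sin (of_real pi * u) = - \<i> * (exp (\<i> * (of_real pi * u)) - exp (- (\<i> * (of_real pi * u))))"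
      proof -
        have "2 * (w / (2 * \<i>)) = - \<i> * w" for w
          by (simp add: complex_eq_iff)
        thus ?thesis unfolding sin_exp_eq .
      qed
      ultimately show ?thesis
        by (simp add: algebra_simps)
    qed
    have "exp (c * h) * S = (exp (2 * (c * h)) * S) * exp (- (c * h))" for S
      using arg_cong[OF e1, of "\<lambda>x. x * S"] by (simp only: mult_ac)
    from this[of "1 - exp (- (2 * \<i> * of_real pi * u))"] show ?thesis unfolding e2 .
  qed
  have "stirling_ratio (1 - a) (\<i> * of_real y) * (1 - exp (- (2 * \<i> * of_real pi * u)))
      = Gamma (1 - u) * exp (c * of_real (ln y)) * exp (\<i> * of_real y) / of_real (sqrt (2 * pi))
        * (exp (c * h) * (1 - exp (- (2 * \<i> * of_real pi * u))))"
    unfolding F by simp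
  also have "\<dots> = Gamma (1 - u) * exp (c * of_real (ln y)) * exp (\<i> * of_real y) * exp (- (c * h))
       * sin (of_real pi * u) * (2 / of_real (sqrt (2 * pi)))"
    unfolding key by simp
  also have "2 / complex_of_real (sqrt (2 * pi)) = of_real (sqrt (2 * pi)) / of_real pi"
  proof -
    have "2 / sqrt (2 * pi) = sqrt (2 * pi) / pi" by (simp add: field_simps)
    hence "complex_of_real (2 / sqrt (2 * pi)) = of_real (sqrt (2 * pi) / pi)" by (rule arg_cong)
    thus ?thesis by (simp only: of_real_divide of_real_numeral)
  qed
  finally show ?thesis unfolding g rG by simp
qed

text \<open>For \<open>y > 0\<close> let \<open>E\<close> be the exponential of the reflection
  identity. Then \<open>F - g = F * E\<close> and \<open>norm E = exp (- (2 * pi * y))\<close>. The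
  phase of \<open>E\<close> varies with \<open>a\<close>, so \<open>F = g / (1 - E)\<close> is
  bounded through \<open>norm (1 - E) \<ge> 1 - norm E\<close>; near \<open>y = 0\<close> this costs
  a factor of order \<open>1 / y\<close>, which is the term with \<open>a - 2\<close>. Conjugation
  covers \<open>y < 0\<close>.\<close>

lemma norm_jump_le:
  assumes "a \<ge> 1" "y \<noteq> 0"
  shows "norm (stirling_ratio (1 - a) (\<i> * of_real y) - inverse_stirling_ratio a (- (\<i> * of_real y)))
           \<le> (\<bar>y\<bar> powr (a - 1) + \<bar>y\<bar> powr (a - 2) / (2 * pi)) * exp (- (2 * pi * \<bar>y\<bar>)) / Gamma a"
proof -
  have pos: "norm (stirling_ratio (1 - a) (\<i> * of_real y) - inverse_stirling_ratio a (- (\<i> * of_real y)))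
           \<le> (\<bar>y\<bar> powr (a - 1) + \<bar>y\<bar> powr (a - 2) / (2 * pi)) * exp (- (2 * pi * \<bar>y\<bar>)) / Gamma a"
    if y: "y > 0" for y
  proof -
    define E where "E = exp (- (2 * \<i> * of_real pi * (of_real a - \<i> * of_real y)))"
    define F where "F = stirling_ratio (1 - a) (\<i> * of_real y)"
    define g where "g = inverse_stirling_ratio a (- (\<i> * of_real y))"
    define x where "x = 2 * pi * y"
    have x: "x > 0" using y by (simp add: x_def)
    have eq: "F * (1 - E) = g"
      unfolding F_def E_def g_def by (rule stirling_ratio_reflection[OF y])
    have E: "norm E = exp (- x)"
      unfolding E_def x_def norm_exp_eq_Re by simp
    have "exp (- x) \<le> 1 / (1 + x)"
      using exp_ge_add_one_self[of x] x by (simp add: exp_minus field_simps)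
    hence "x / (1 + x) \<le> 1 - exp (- x)" using x by (simp add: field_simps)
    also have "\<dots> \<le> norm (1 - E)" using norm_triangle_ineq2[of 1 E] E by simp
    finally have "norm F * (x / (1 + x)) \<le> norm F * norm (1 - E)" by (intro mult_left_mono) auto
    also have "\<dots> = norm g" unfolding eq[symmetric] norm_mult ..
    finally have "norm F * (x / (1 + x)) \<le> norm g" .
    hence "norm F \<le> norm g * (1 + 1 / x)" using x by (simp add: field_simps)
    also have "norm g \<le> y powr (a - 1) / Gamma a"
      using norm_inverse_stirling_ratio_imaginary[OF assms(1), of "- y"] y by (simp add: g_def)
    hence "norm g * (1 + 1 / x) \<le> y powr (a - 1) / Gamma a * (1 + 1 / x)"
      using x by (intro mult_right_mono) auto
    finally have F: "norm F \<le> y powr (a - 1) / Gamma a * (1 + 1 / x)" .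
    have "F - g = F * E" unfolding eq[symmetric] by (simp add: algebra_simps)
    hence "norm (F - g) = norm F * exp (- x)" by (simp add: norm_mult E)
    also have "\<dots> \<le> y powr (a - 1) / Gamma a * (1 + 1 / x) * exp (- x)"
      using F by (intro mult_right_mono) auto
    also have "\<dots> = (y powr (a - 1) * (1 + 1 / x)) * exp (- x) / Gamma a" by simp
    also have "y powr (a - 1) * (1 + 1 / x) = y powr (a - 1) + y powr (a - 2) / (2 * pi)"
      using y powr_add[of y "a - 2" 1] by (simp add: x_def field_simps)
    finally show ?thesis using y by (simp add: F_def g_def x_def)
  qed
  show ?thesis
  proof (cases "y > 0")
    case False
    hence y: "- y > 0" using assms by simp
    have "stirling_ratio (1 - a) (\<i> * of_real y) = cnj (stirling_ratio (1 - a) (\<i> * of_real (- y)))"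
      using cnj_stirling_ratio[of "\<i> * of_real (- y)" "1 - a"] assms by simp
    moreover have "inverse_stirling_ratio a (- (\<i> * of_real y))
        = cnj (inverse_stirling_ratio a (- (\<i> * of_real (- y))))"
      using cnj_inverse_stirling_ratio[of "- (\<i> * of_real (- y))" a] by simp
    ultimately have "norm (stirling_ratio (1 - a) (\<i> * of_real y) - inverse_stirling_ratio a (- (\<i> * of_real y)))
      = norm (stirling_ratio (1 - a) (\<i> * of_real (- y)) - inverse_stirling_ratio a (- (\<i> * of_real (- y))))"
      by (simp only: complex_cnj_diff[symmetric] complex_mod_cnj)
    with pos[OF y] show ?thesis by (simp only: abs_minus_cancel)
  qed (rule pos)
qed

section \<open>The integral of the jump\<close>

lemma continuous_on_powr_nonneg:
  fixes f :: "'a :: topological_space \<Rightarrow> real"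
  assumes "continuous_on S f" "\<And>x. x \<in> S \<Longrightarrow> f x \<ge> 0" "c > 0"
  shows "continuous_on S (\<lambda>x. f x powr c)"
  using assms by (intro continuous_on_powr') auto

lemma incomplete_Gamma_integral_le:
  fixes s m R :: real
  assumes "s > 1" "m > 0" "R > 0"
  shows "integral {0..R} (\<lambda>y. y powr (s - 1) * exp (- (m * y))) \<le> Gamma s / m powr s"
    and "(\<lambda>y. y powr (s - 1) * exp (- (m * y))) integrable_on {0..R}"
proof -
  define f :: "real \<Rightarrow> real" where "f = (\<lambda>t. t powr (s - 1) / exp t)"
  have G: "(f has_integral Gamma s) {0..}"
    unfolding f_def using assms by (intro Gamma_integral_real) auto
  have cont: "continuous_on {0..x} (\<lambda>y. y powr (s - 1) * exp (- (c * y)))" for x c :: real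
    by (rule continuous_on_mult[OF continuous_on_powr_nonneg])
       (use assms in \<open>auto intro!: continuous_intros\<close>)
  show int: "(\<lambda>y. y powr (s - 1) * exp (- (m * y))) integrable_on {0..R}"
    by (intro integrable_continuous_real cont)
  have f_eq: "f = (\<lambda>y. y powr (s - 1) * exp (- (1 * y)))"
    by (simp add: f_def exp_minus field_simps)
  have f_int: "f integrable_on {0..m * R}"
    unfolding f_eq by (rule integrable_continuous_real[OF cont])
  have "integral {0..m * R} f \<le> integral {0..} f"
    using G f_int by (intro integral_subset_le) (auto simp: f_def)
  hence le: "integral {0..m * R} f \<le> Gamma s" using G by (simp add: integral_unique)
  have "m powr (s - 1) * integral {0..R} (\<lambda>y. y powr (s - 1) * exp (- (m * y)))
      = integral {0..R} (\<lambda>y. f (m * y))"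
    unfolding integral_mult_right[symmetric]
    by (rule integral_cong) (use assms in \<open>simp add: f_def powr_mult exp_minus field_simps\<close>)
  also have "\<dots> = (1 / m) * integral {0..m * R} f"
    using integral_stretch_real[of m 0 "m * R" f] assms by simp
  also have "\<dots> \<le> (1 / m) * Gamma s" using assms le by (intro mult_left_mono) auto
  finally have *: "m powr (s - 1) * integral {0..R} (\<lambda>y. y powr (s - 1) * exp (- (m * y))) \<le> Gamma s / m"
    by simp
  have "m powr (s - 1) * integral {0..R} (\<lambda>y. y powr (s - 1) * exp (- (m * y))) * m \<le> Gamma s"
    using * assms by (simp add: field_simps)
  moreover have "m powr s = m powr (s - 1) * m" using assms powr_add[of m "s - 1" 1] by simp
  ultimately show "integral {0..R} (\<lambda>y. y powr (s - 1) * exp (- (m * y))) \<le> Gamma s / m powr s"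
    using assms by (simp add: field_simps)
qed

definition jump_bound :: "real \<Rightarrow> real \<Rightarrow> real" where
  "jump_bound a y = (\<bar>y\<bar> powr (a - 1) + \<bar>y\<bar> powr (a - 2) / (2 * pi)) * exp (- (2 * pi * \<bar>y\<bar>)) / Gamma a"

lemma jump_bound_integrable:
  assumes "a \<ge> 3"
  shows "jump_bound a integrable_on {-R..R}"
proof (rule integrable_continuous_real)
  have "Gamma a > 0" using assms by (intro Gamma_real_pos) auto
  hence "Gamma a \<noteq> 0" by simp
  moreover have "continuous_on {-R..R} (\<lambda>y. \<bar>y\<bar> powr c)" if "c > 0" for c
    using that by (intro continuous_on_powr_nonneg continuous_on_rabs continuous_on_id) auto
  ultimately show "continuous_on {-R..R} (jump_bound a)"
    unfolding jump_bound_def using assms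
    by (intro continuous_on_divide continuous_on_mult continuous_on_add) (auto intro!: continuous_intros)
qed

text \<open>The two terms are incomplete Gamma integrals with parameters \<open>a\<close> and
  \<open>a - 1\<close>. After division by \<open>Gamma a\<close>, a half-axis contributes at most
  \<open>1 + 1 / (a - 1) \<le> 3 / 2\<close> times \<open>(2 * pi) powr (- a)\<close>, and the two
  half-axes together give the 3.\<close>

lemma integral_jump_bound_le:
  assumes "a \<ge> 3" "R > 0"
  shows "integral {-R..R} (jump_bound a) \<le> 3 / (2 * pi) powr a"
proof -
  have a: "Gamma a > 0" "Gamma (a - 1) > 0" using assms by (auto intro!: Gamma_real_pos)
  hence nz: "Gamma a \<noteq> 0" "Gamma (a - 1) \<noteq> 0" by simp_all
  have rec: "Gamma a = (a - 1) * Gamma (a - 1)"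
    using Gamma_plus1[of "a - 1"] assms by (force elim!: nonpos_Ints_cases)
  have half: "integral {0..R} (jump_bound a) \<le> 3 / 2 / (2 * pi) powr a"
  proof -
    define I where "I = (\<lambda>s. integral {0..R} (\<lambda>y. y powr (s - 1) * exp (- (2 * pi * y))))"
    have I: "I s \<le> Gamma s / (2 * pi) powr s"
      "(\<lambda>y. y powr (s - 1) * exp (- (2 * pi * y))) integrable_on {0..R}" if "s > 1" for s
      unfolding I_def using incomplete_Gamma_integral_le[of s "2 * pi" R] that assms by auto
    have "integral {0..R} (jump_bound a) = integral {0..R} (\<lambda>y. 1 / Gamma a * (y powr (a - 1) * exp (- (2 * pi * y)))
        + 1 / (2 * pi * Gamma a) * (y powr ((a - 1) - 1) * exp (- (2 * pi * y))))"
      by (rule integral_cong) (use nz in \<open>simp add: jump_bound_def field_simps\<close>)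
    also have "\<dots> = 1 / Gamma a * I a + 1 / (2 * pi * Gamma a) * I (a - 1)"
    proof -
      have int: "(\<lambda>y. c * (y powr (s - 1) * exp (- (2 * pi * y)))) integrable_on {0..R}" if "s > 1" for c s
        by (rule integrable_on_mult_right[OF I(2)[OF that]])
      thus ?thesis
        unfolding I_def integral_mult_right[symmetric] 
        by (intro integral_add int) (use assms in auto)
    qed
    also have "\<dots> \<le> 1 / Gamma a * (Gamma a / (2 * pi) powr a)
        + 1 / (2 * pi * Gamma a) * (Gamma (a - 1) / (2 * pi) powr (a - 1))"
      using a assms by (intro add_mono mult_left_mono I) auto
    also have "\<dots> = (1 + 1 / (a - 1)) / (2 * pi) powr a"
    proof -
      have "(2 * pi) powr a = (2 * pi) powr (a - 1) * (2 * pi)"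
        using powr_add[of "2 * pi" "a - 1" 1] by simp
      hence "1 / (2 * pi * Gamma a) * (Gamma (a - 1) / (2 * pi) powr (a - 1)) = 1 / (a - 1) / (2 * pi) powr a"
        unfolding rec using nz assms by (simp add: field_simps)
      thus ?thesis using nz by (simp add: add_divide_distrib)
    qed
    also have "\<dots> \<le> (3 / 2) / (2 * pi) powr a"
      using assms by (intro divide_right_mono) (auto simp: field_simps)
    finally show ?thesis .
  qed
  have int: "jump_bound a integrable_on {-R..R}" by (rule jump_bound_integrable[OF assms(1)])
  have "integral {-R..R} (jump_bound a) = integral {-R..0} (jump_bound a) + integral {0..R} (jump_bound a)"
    using assms int by (intro Henstock_Kurzweil_Integration.integral_combine[symmetric]) auto
  also have "integral {-R..0} (jump_bound a) = integral {0..R} (jump_bound a)"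
  proof -
    have "(\<lambda>y. jump_bound a (- y)) = jump_bound a" by (simp add: jump_bound_def fun_eq_iff)
    thus ?thesis
      using Henstock_Kurzweil_Integration.integral_reflect_real[where a = 0 and b = R and f = "jump_bound a"] by simp
  qed
  finally show ?thesis using half by simp
qed

section \<open>Residues of \<open>F\<close> and the Spouge coefficients\<close>

lemma prod_diff_atLeastAtMost:
  fixes N k :: nat
  assumes "k \<in> {1..N}"
  shows "(\<Prod>j\<in>{1..N} - {k}. real j - real k) = (-1) ^ (k - 1) * fact (k - 1) * fact (N - k)"
proof -
  have "{1..N} - {k} = {1..<k} \<union> {k<..N}" using assms by auto
  hence "(\<Prod>j\<in>{1..N} - {k}. real j - real k) = (\<Prod>j\<in>{1..<k} \<union> {k<..N}. real j - real k)" by (rule arg_cong)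
  also have "\<dots> = (\<Prod>j\<in>{1..<k}. real j - real k) * (\<Prod>j\<in>{k<..N}. real j - real k)"
    by (rule prod.union_disjoint) auto
  also have "(\<Prod>j\<in>{1..<k}. real j - real k) = (\<Prod>i\<in>{1..k-1}. - real i)"
    by (rule prod.reindex_bij_witness[of _ "\<lambda>i. k - i" "\<lambda>j. k - j"]) (use assms in \<open>auto simp: of_nat_diff\<close>)
  also have "\<dots> = (-1) ^ (k - 1) * fact (k - 1)"
    by (simp add: prod_uminus fact_prod)
  also have "(\<Prod>j\<in>{k<..N}. real j - real k) = (\<Prod>i\<in>{1..N-k}. real i)"
    by (rule prod.reindex_bij_witness[of _ "\<lambda>i. i + k" "\<lambda>j. j - k"]) (use assms in \<open>auto simp: of_nat_diff\<close>)
  also have "\<dots> = fact (N - k)" by (simp add: fact_prod)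
  finally show ?thesis .
qed

text \<open>Let \<open>m = spouge_terms a\<close>. At \<open>p = a - k\<close> the shifted Gamma is
  \<open>(m - k + 1)!\<close> and the correcting quotient is \<open>p / (m - k + 1)\<close>. The
  remaining \<open>(m - k)!\<close> cancels against the poles to the left of \<open>p\<close>, and
  those to the right give \<open>(-1) ^ (k - 1) * (k - 1)!\<close>. What is left does not depend on
  \<open>m\<close>.\<close>

lemma spouge_regular_pole:
  assumes "a \<ge> 3" "k \<in> {1..spouge_terms a}"
  defines "p \<equiv> complex_of_real (a - real k)"
  shows "spouge_regular a p / (\<Prod>p'\<in>spouge_poles a - {p}. p - p') = of_real (spouge_coeff a k)"
proof -
  define N where "N = spouge_terms a"
  define r where "r = a - real k"
  have k: "k \<ge> 1" "k \<le> N" using assms by (auto simp: N_def)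
  have r: "r > 0" using spouge_terms_bounds(1)[of a] assms by (simp add: r_def)
  have p: "p = of_real r" "p \<noteq> 0" using r by (auto simp: p_def r_def simp del: of_real_diff)
  have "spouge_poles a - {p} = (\<lambda>j. of_real (a - real j)) ` ({1..N} - {k})"
    unfolding spouge_poles_def p_def N_def using assms inj_spouge_pole[of a]
    by (subst inj_on_image_set_diff[OF inj_spouge_pole[of a UNIV]]) auto
  hence "(\<Prod>p'\<in>spouge_poles a - {p}. p - p') = (\<Prod>j\<in>{1..N} - {k}. p - of_real (a - real j))"
    by (simp only: prod.reindex[OF inj_spouge_pole] o_def)
  also have "\<dots> = (\<Prod>j\<in>{1..N} - {k}. of_real (real j - real k))"
    by (intro prod.cong) (auto simp: p_def)
  also have "\<dots> = of_real ((-1) ^ (k - 1) * fact (k - 1) * fact (N - k))"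
    unfolding of_real_prod[symmetric] by (subst prod_diff_atLeastAtMost) (use k in auto)
  finally have P: "(\<Prod>p'\<in>spouge_poles a - {p}. p - p') = of_real ((-1) ^ (k - 1) * fact (k - 1) * fact (N - k))" .
  have G: "Gamma (p + of_real (real N + 2 - a)) = of_nat (Suc (N - k)) * fact (N - k)"
  proof -
    have "p + of_real (real N + 2 - a) = 1 + of_nat (Suc (N - k))"
      using k by (simp add: p_def of_nat_diff)
    thus ?thesis by (simp only: Gamma_fact fact_Suc)
  qed
  have d: "p + of_real (real N + 2 - a) - 1 = of_nat (Suc (N - k))"
    using k by (simp add: p_def of_nat_diff)
  have K: "power_kernel (a - 3/2) (- 1) p * p = of_real (r powr (real k - 1/2))"
  proof -
    have "(of_real (a - 3/2) + - 1 * p) * Ln p = of_real ((real k - 3/2) * ln r)"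
      using r by (simp add: p Ln_of_real) (simp add: r_def)
    hence "exp ((of_real (a - 3/2) + - 1 * p) * Ln p) = of_real (exp ((real k - 3/2) * ln r))"
      by (simp only: exp_of_real)
    hence "power_kernel (a - 3/2) (- 1) p * p = of_real (exp ((real k - 3/2) * ln r) * r)"
      using p(2) by (simp only: power_kernel_def if_False of_real_mult p(1)[symmetric])
    also have "exp ((real k - 3/2) * ln r) = r powr (real k - 3/2)" using r by (simp add: powr_def)
    also have "r powr (real k - 3/2) * r = r powr (real k - 1/2)"
      using powr_add[of r "real k - 3/2" 1] r by simp
    finally show ?thesis .
  qed
  have "spouge_regular a p = of_nat (Suc (N - k)) * fact (N - k) * exp p / of_real (sqrt (2 * pi))
      * (power_kernel (a - 3/2) (- 1) p * p) / of_nat (Suc (N - k))"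
    unfolding spouge_regular_def Let_def N_def[symmetric] G d by simp
  also have "\<dots> = of_real (fact (N - k) * exp r / sqrt (2 * pi) * r powr (real k - 1/2))"
    unfolding K by (simp add: p(1) exp_of_real del: of_nat_Suc)
  finally have reg: "spouge_regular a p = of_real (fact (N - k) * exp r / sqrt (2 * pi) * r powr (real k - 1/2))" .
  have "spouge_regular a p / (\<Prod>p'\<in>spouge_poles a - {p}. p - p')
      = of_real (fact (N - k) * exp r / sqrt (2 * pi) * r powr (real k - 1/2)
          / ((-1) ^ (k - 1) * fact (k - 1) * fact (N - k)))"
    by (simp only: P reg of_real_divide)
  also have "fact (N - k) * exp r / sqrt (2 * pi) * r powr (real k - 1/2)
          / ((-1) ^ (k - 1) * fact (k - 1) * fact (N - k)) = spouge_coeff a k"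
  proof -
    have alg: "F * e / s * q / (u * f * F) = 1 / s * (u / f) * q * e"
      if "u * u = 1" "F \<noteq> 0" for F e s q u f :: real
    proof -
      have "1 / u = u" using that by (metis div_by_1 divide_divide_eq_right mult.commute nonzero_eq_divide_eq zero_neq_one mult_zero_left)
      have "F * e / s * q / (u * f * F) = e / s * q * (1 / u) / f" using that by simp
      also have "1 / u = u" by fact
      finally show ?thesis by simp
    qed
    have "(-1) ^ (k - 1) * (-1) ^ (k - 1) = (1 :: real)"
      by (simp flip: power_mult_distrib)
    hence "fact (N - k) * exp r / sqrt (2 * pi) * r powr (real k - 1/2)
          / ((-1) ^ (k - 1) * fact (k - 1) * fact (N - k))
        = 1 / sqrt (2 * pi) * ((-1) ^ (k - 1) / fact (k - 1)) * r powr (real k - 1/2) * exp r"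
      by (rule alg) simp
    also have "\<dots> = spouge_coeff a k"
      using k by (simp add: spouge_coeff_def r_def)
    finally show ?thesis .
  qed
  finally show ?thesis .
qed

text \<open>Maximum principle on a large half-disc: on the straight side the modulus is at most 1
  because the exponent \<open>a - 1\<close> of the bound on the axis is 0, and on the arc the
  function is close to its limit 1.\<close>

lemma norm_inverse_stirling_ratio_1_le:
  assumes "Re w > 0"
  shows "norm (inverse_stirling_ratio 1 w) \<le> 1"
proof (rule field_le_epsilon)
  fix e :: real assume e: "e > 0"
  obtain R where R: "\<And>z. Re z \<ge> 0 \<Longrightarrow> norm z \<ge> R \<Longrightarrow> norm (inverse_stirling_ratio 1 z - 1) < e"
    using tendstoD[OF inverse_stirling_ratio_tendsto[of 1] e]
    unfolding eventually_right_at_infinity dist_norm by auto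
  define r where "r = max R (norm w + 1)"
  define S where "S = {z. Re z > 0} \<inter> ball 0 r"
  have "open S" unfolding S_def by (intro open_Int open_halfspace_Re_gt open_ball)
  have closure: "closure S \<subseteq> {z. Re z \<ge> 0} \<inter> cball 0 r"
    by (rule closure_minimal) (auto simp: S_def closed_halfspace_Re_ge intro!: closed_Int)
  show "norm (inverse_stirling_ratio 1 w) \<le> 1 + e"
  proof (rule maximum_modulus_frontier[where f = "inverse_stirling_ratio 1" and \<xi> = w and S = S])
    show "inverse_stirling_ratio 1 holomorphic_on interior S"
      unfolding interior_open[OF \<open>open S\<close>]
      by (rule holomorphic_on_subset[OF holomorphic_on_inverse_stirling_ratio]) (auto simp: S_def)
    show "continuous_on (closure S) (inverse_stirling_ratio 1)"
      using closure by (intro continuous_on_subset[OF continuous_on_inverse_stirling_ratio]) auto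
    show "bounded S" unfolding S_def by (intro bounded_Int) auto
    show "w \<in> S" using assms by (auto simp: S_def r_def)
    fix z assume "z \<in> frontier S"
    hence "z \<in> closure S" "z \<notin> S"
      using interior_open[OF \<open>open S\<close>] by (auto simp: frontier_def)
    hence z: "Re z \<ge> 0" "norm z \<le> r" "Re z = 0 \<or> norm z = r"
      using closure by (auto simp: S_def)
    show "norm (inverse_stirling_ratio 1 z) \<le> 1 + e"
    proof (cases "Re z = 0")
      case True
      hence "z = \<i> * of_real (Im z)" by (simp add: complex_eq_iff)
      hence "norm (inverse_stirling_ratio 1 z) \<le> \<bar>Im z\<bar> powr 0"
        using norm_inverse_stirling_ratio_imaginary[of 1 "Im z"] by simp
      \<comment> \<open>At the origin \<open>0 powr 0\<close> is 0, in accordance with the value of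
        the function there.\<close>
      also have "\<dots> \<le> 1" by simp
      finally show ?thesis using e by simp
    next
      case False
      hence "norm (inverse_stirling_ratio 1 z - 1) < e" using z R by (auto simp: r_def)
      thus ?thesis using norm_triangle_ineq2[of "inverse_stirling_ratio 1 z" 1] by simp
    qed
  qed
qed

text \<open>The norm increases with \<open>c\<close>, so that only \<open>c = 0\<close> needs the maximum principle.\<close>

lemma norm_stirling_ratio_ge_1:
  assumes "Re w > 0" "c \<ge> 0"
  shows "norm (stirling_ratio (- c) (w + of_real c)) \<ge> 1"
proof -
  have w: "w \<noteq> 0" using assms by auto
  define \<phi> where "\<phi> = (\<lambda>t. Re ((1/2 - w) * Ln (w + of_real t) + (w + of_real t)))"
  have shape: "norm (stirling_ratio (- t) (w + of_real t)) = norm (Gamma w) * exp (\<phi> t) / sqrt (2 * pi)" for t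
  proof -
    have "1/2 - complex_of_real (- t) - (w + of_real t) = 1/2 - w" by simp
    moreover have "w + of_real t + of_real (- t) = w" by simp
    ultimately show ?thesis
      unfolding stirling_ratio_def \<phi>_def norm_divide norm_mult norm_exp_eq_Re by simp
  qed
  \<comment> \<open>With the argument of Gamma fixed at \<open>w\<close>, only \<open>\<phi>\<close>
    depends on the shift. Its derivative is the real part of \<open>(1/2 + t) / (w + t)\<close>,
    which is nonnegative since \<open>w + t\<close> lies in the right half-plane.\<close>
  have "\<phi> 0 \<le> \<phi> c"
  proof (rule DERIV_nonneg_imp_nondecreasing[OF assms(2)])
    fix t :: real assume t: "0 \<le> t" "t \<le> c"
    have nz: "w + of_real t \<noteq> 0" "w + of_real t \<notin> \<real>\<^sub>\<le>\<^sub>0"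
      using assms t by (auto simp: complex_eq_iff complex_nonpos_Reals_iff)
    have "((\<lambda>t. (1/2 - w) * Ln (w + t) + (w + t)) has_field_derivative
        ((1/2 - w) / (w + of_real t) + 1)) (at (of_real t))"
      using nz by (auto intro!: derivative_eq_intros simp: inverse_eq_divide)
    hence "((\<lambda>t. (1/2 - w) * Ln (w + of_real t) + (w + of_real t)) has_vector_derivative
        ((1/2 - w) / (w + of_real t) + 1)) (at t)"
      by (rule has_vector_derivative_real_field)
    hence "(\<phi> has_field_derivative Re ((1/2 - w) / (w + of_real t) + 1)) (at t)"
      unfolding \<phi>_def by (rule has_field_derivative_Re)
    moreover have "(1/2 - w) / (w + of_real t) + 1 = of_real (1/2 + t) / (w + of_real t)"
    proof -
      have "(1/2 - w) / (w + of_real t) + 1 = (1/2 - w) / (w + of_real t) + (w + of_real t) / (w + of_real t)"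
        using nz by simp
      also have "\<dots> = of_real (1/2 + t) / (w + of_real t)"
        unfolding add_divide_distrib[symmetric] by simp
      finally show ?thesis .
    qed
    moreover have "Re (of_real (1/2 + t) / (w + of_real t)) \<ge> 0"
      using assms t by (simp add: Re_divide)
    ultimately show "\<exists>y. (\<phi> has_real_derivative y) (at t) \<and> 0 \<le> y" by auto
  qed
  hence "norm (stirling_ratio (- 0) (w + of_real 0)) \<le> norm (stirling_ratio (- c) (w + of_real c))"
    unfolding shape by (intro divide_right_mono mult_left_mono) auto
  moreover have "norm (stirling_ratio 0 w) \<ge> 1"
  proof -
    \<comment> \<open>The maximum principle was applied with shift 1. The shifts 0 and 1 give the
      same function, because \<open>Gamma (w + 1) = w * Gamma w\<close>.\<close>
    have eq: "stirling_ratio 0 w = stirling_ratio 1 w"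
      using stirling_ratio_Suc[of w 0] assms w by simp
    have "norm (stirling_ratio 1 w) > 0"
      using stirling_ratio_nonzero[of 1 w] assms by (auto simp: complex_eq_iff)
    moreover have "inverse (norm (stirling_ratio 1 w)) \<le> 1"
      using norm_inverse_stirling_ratio_1_le[OF assms(1)] w
      by (simp add: inverse_stirling_ratio_eq norm_inverse)
    ultimately show ?thesis unfolding eq by (simp add: field_simps)
  qed
  ultimately show ?thesis by simp
qed

definition spouge_scalar :: "real \<Rightarrow> complex \<Rightarrow> complex" where
  "spouge_scalar a z =
     of_real (sqrt (2 * pi)) * exp (Ln (z + of_real (a - 1)) * (z - 1/2)) * exp (- (z + of_real (a - 1)))
     * (of_real (spouge_coeff a 0)
        + (\<Sum>k = 1..spouge_terms a. of_real (spouge_coeff a k) * inverse (z + of_real (real k - 1))))"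

text \<open>\<open>Gamma z\<close> is \<open>W * F\<close> and the approximation is
  \<open>W * (1 + s)\<close> with the same prefactor \<open>W\<close>, so only the distance of
  \<open>F\<close> from \<open>1 + s\<close> has to be measured.\<close>

theorem spouge_scalar_error:
  assumes "a \<ge> 3" "Re z > 0"
  shows "norm (Gamma z - spouge_scalar a z)
           \<le> norm (Gamma z) * (sqrt a / ((2 * pi) powr (a - 1/2) * (Re z - 1 + a)))"
proof -
  define N where "N = spouge_terms a"
  define \<zeta> where "\<zeta> = z + of_real (a - 1)"
  have \<zeta>: "Re \<zeta> = Re z - 1 + a" "Re \<zeta> > 0" "\<zeta> \<noteq> 0" using assms by (auto simp: \<zeta>_def complex_eq_iff)
  define F where "F = stirling_ratio (1 - a) \<zeta>"
  define s where "s = (\<Sum>k = 1..N. of_real (spouge_coeff a k) * inverse (z + of_real (real k - 1)))"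
  define W where "W = of_real (sqrt (2 * pi)) * exp (Ln \<zeta> * (z - 1/2)) * exp (- \<zeta>)"
  \<comment> \<open>The real part of \<open>\<zeta>\<close> exceeds \<open>a - 1\<close>, the
    rightmost pole.\<close>
  have notin: "\<zeta> \<notin> spouge_poles a"
  proof
    assume "\<zeta> \<in> spouge_poles a"
    then obtain k where k: "\<zeta> = of_real (a - real k)" "k \<ge> 1" by (auto simp: spouge_poles_def)
    hence "Re \<zeta> = a - real k" by simp
    thus False using k \<zeta> assms by simp
  qed
  have "norm (spouge_regular a \<zeta> / (\<Prod>p\<in>spouge_poles a. \<zeta> - p)
      + (\<Sum>p\<in>spouge_poles a. spouge_regular a p / ((p - \<zeta>) * (\<Prod>p'\<in>spouge_poles a - {p}. p - p'))) - 1)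
      \<le> (3 / (2 * pi) powr a) / (2 * pi * Re \<zeta>)"
  proof (rule half_plane_jump_bound[where g = "inverse_stirling_ratio a" and B = "jump_bound a"])
    fix y :: real
    show "norm (spouge_regular a (\<i> * of_real y) / (\<Prod>p\<in>spouge_poles a. \<i> * of_real y - p)
        - inverse_stirling_ratio a (- (\<i> * of_real y))) \<le> jump_bound a y"
    proof (cases "y = 0")
      \<comment> \<open>Both functions take the value 0 at the origin, and
        \<open>jump_bound a 0\<close> is 0 as well.\<close>
      case True
      thus ?thesis
        by (simp add: spouge_regular_def inverse_stirling_ratio_def power_kernel_def jump_bound_def)
    next
      case False
      have "\<i> * of_real y \<notin> spouge_poles a"
        using Re_spouge_poles[of a "\<i> * of_real y"] assms by auto
      thus ?thesis
        using norm_jump_le[of a y] False assms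
        by (subst spouge_regular_divide) (auto simp: jump_bound_def)
    qed
    show "continuous_on {z. Re z \<ge> 0} (spouge_regular a)"
      by (rule continuous_on_spouge_regular[OF assms(1)])
    show "spouge_regular a holomorphic_on {z. Re z > 0}"
      by (rule holomorphic_on_spouge_regular[OF assms(1)])
    show "continuous_on {z. Re z \<ge> 0} (inverse_stirling_ratio a)"
      using assms by (intro continuous_on_inverse_stirling_ratio) auto
    show "inverse_stirling_ratio a holomorphic_on {z. Re z > 0}"
      by (rule holomorphic_on_inverse_stirling_ratio)
    show "finite (spouge_poles a)" by (simp add: spouge_poles_def)
    show "Re p > 0" if "p \<in> spouge_poles a" for p
      using Re_spouge_poles[OF _ that] assms by auto
    show "((\<lambda>w. spouge_regular a w / (\<Prod>p\<in>spouge_poles a. w - p)) \<longlongrightarrow> 1) right_at_infinity"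
      by (rule spouge_regular_divide_tendsto[OF assms(1)])
    show "(inverse_stirling_ratio a \<longlongrightarrow> 1) right_at_infinity"
      using assms by (intro inverse_stirling_ratio_tendsto) auto
    show "jump_bound a integrable_on {-R..R}" for R
      by (rule jump_bound_integrable[OF assms(1)])
    show "integral {-R..R} (jump_bound a) \<le> 3 / (2 * pi) powr a" if "R > 0" for R
      by (rule integral_jump_bound_le[OF assms(1) that])
  qed (rule \<zeta> notin)+
  also have "spouge_regular a \<zeta> / (\<Prod>p\<in>spouge_poles a. \<zeta> - p) = F"
    unfolding F_def using assms \<zeta> notin by (intro spouge_regular_divide) auto
  also have "(\<Sum>p\<in>spouge_poles a. spouge_regular a p / ((p - \<zeta>) * (\<Prod>p'\<in>spouge_poles a - {p}. p - p'))) = - s"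
  proof -
    have "(\<Sum>p\<in>spouge_poles a. spouge_regular a p / ((p - \<zeta>) * (\<Prod>p'\<in>spouge_poles a - {p}. p - p')))
        = (\<Sum>p\<in>spouge_poles a. spouge_regular a p / (\<Prod>p'\<in>spouge_poles a - {p}. p - p') / (p - \<zeta>))"
      by (simp add: mult.commute)
    also have "\<dots> = (\<Sum>k\<in>{1..N}. of_real (spouge_coeff a k) / (of_real (a - real k) - \<zeta>))"
      unfolding spouge_poles_def[of a] sum.reindex[OF inj_spouge_pole] o_def N_def
      using spouge_regular_pole[OF assms(1)]
      by (intro sum.cong refl) (simp only: spouge_poles_def)
    also have "\<dots> = - s"
      unfolding s_def sum_negf[symmetric]
    proof (intro sum.cong refl)
      fix k
      have "of_real (a - real k) - \<zeta> = - (z + of_real (real k - 1))" by (simp add: \<zeta>_def)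
      thus "of_real (spouge_coeff a k) / (of_real (a - real k) - \<zeta>)
          = - (of_real (spouge_coeff a k) * inverse (z + of_real (real k - 1)))"
        by (simp only: divide_inverse inverse_minus_eq mult_minus_right)
    qed
    finally show ?thesis .
  qed
  finally have X: "norm (F - s - 1) \<le> (3 / (2 * pi) powr a) / (2 * pi * Re \<zeta>)" by simp
  have "Gamma z = W * F"
  proof -
    have "W * F = Gamma z * (exp (Ln \<zeta> * (z - 1/2) + - \<zeta>) * exp ((1/2 - of_real (1 - a) - \<zeta>) * Ln \<zeta> + \<zeta>))"
      unfolding W_def F_def stirling_ratio_def exp_add by (simp add: \<zeta>_def)
    also have "exp (Ln \<zeta> * (z - 1/2) + - \<zeta>) * exp ((1/2 - of_real (1 - a) - \<zeta>) * Ln \<zeta> + \<zeta>) = exp 0"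
      unfolding exp_add[symmetric] by (rule arg_cong[of _ _ exp]) (simp add: \<zeta>_def algebra_simps)
    finally show ?thesis by simp
  qed
  moreover have "spouge_scalar a z = W * (1 + s)"
    by (simp add: spouge_scalar_def W_def s_def N_def \<zeta>_def spouge_coeff_def)
  ultimately have "Gamma z - spouge_scalar a z = W * (F - s - 1)"
    by (simp add: algebra_simps)
  hence "norm (Gamma z - spouge_scalar a z) = norm W * norm (F - s - 1)" by (simp add: norm_mult)
  also have "\<dots> \<le> norm (Gamma z) * ((3 / (2 * pi) powr a) / (2 * pi * Re \<zeta>))"
  proof (intro mult_mono X)
    have "norm F \<ge> 1"
      unfolding F_def \<zeta>_def using norm_stirling_ratio_ge_1[of z "a - 1"] assms by simp
    hence "norm W * 1 \<le> norm W * norm F" by (intro mult_left_mono) auto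
    thus "norm W \<le> norm (Gamma z)" using \<open>Gamma z = W * F\<close> by (simp add: norm_mult)
  qed auto
  \<comment> \<open>The estimate reached is \<open>3 / ((2 * pi) powr (a + 1) * Re \<zeta>)\<close>.
    It is below the target because \<open>3 \<le> 2 * pi\<close> and
    \<open>1 \<le> sqrt a * sqrt (2 * pi)\<close>.\<close>
  also have "(3 / (2 * pi) powr a) / (2 * pi * Re \<zeta>) \<le> sqrt a / ((2 * pi) powr (a - 1/2) * Re \<zeta>)"
  proof -
    have "(2 * pi) powr a = (2 * pi) powr (a - 1/2) * sqrt (2 * pi)"
      using powr_add[of "2 * pi" "a - 1/2" "1/2"] by (simp add: powr_half_sqrt)
    moreover have "3 / (2 * pi) \<le> 1" using pi_gt3 by simp
    moreover have "1 * 1 \<le> sqrt a * sqrt (2 * pi)"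
    proof (rule mult_mono)
      show "1 \<le> sqrt a" "1 \<le> sqrt (2 * pi)"
        using assms pi_gt3 by (simp_all only: real_sqrt_ge_1_iff)
    qed (use assms in auto)
    moreover have "3 / (2 * pi) \<le> sqrt a * sqrt (2 * pi)"
      using calculation by linarith
    ultimately have "3 / (2 * pi) / (2 * pi) powr a \<le> sqrt a * sqrt (2 * pi) / ((2 * pi) powr (a - 1/2) * sqrt (2 * pi))"
      by (intro frac_le) auto
    hence "3 / (2 * pi) / (2 * pi) powr a / Re \<zeta> \<le> sqrt a / (2 * pi) powr (a - 1/2) / Re \<zeta>"
      using \<zeta> by (intro divide_right_mono) auto
    thus ?thesis by (simp add: field_simps)
  qed
  hence "norm (Gamma z) * ((3 / (2 * pi) powr a) / (2 * pi * Re \<zeta>))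
      \<le> norm (Gamma z) * (sqrt a / ((2 * pi) powr (a - 1/2) * Re \<zeta>))"
    by (intro mult_left_mono) auto
  finally show ?thesis by (simp only: \<zeta>(1))
qed


subsection \<open>Functions of diagonalizable matrices\<close>

lemma matrix_inv_unique:
  fixes A B :: "'a::semiring_1 ^ 'n ^ 'n"
  assumes "A ** B = mat 1" "B ** A = mat 1"
  shows "matrix_inv A = B"
proof -
  have "A ** matrix_inv A = mat 1 \<and> matrix_inv A ** A = mat 1"
    unfolding matrix_inv_def by (rule someI[of _ B]) (use assms in auto)
  thus ?thesis using assms(1) by (metis matrix_mul_assoc matrix_mul_lid matrix_mul_rid)
qed

lemma matrix_inv_inverse:
  fixes A :: "'a::semiring_1 ^ 'n ^ 'n"
  assumes "invertible A"
  shows "A ** matrix_inv A = mat 1" "matrix_inv A ** A = mat 1"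
  using assms matrix_inv_unique unfolding invertible_def by blast+

lemma exists_interpolating_poly:
  fixes f :: "'a :: field \<Rightarrow> 'a"
  assumes "finite X"
  shows "\<exists>q. \<forall>x\<in>X. poly q x = f x"
  using assms
proof (induction X)
  case (insert a X)
  then obtain q where q: "\<And>x. x \<in> X \<Longrightarrow> poly q x = f x" by blast
  define r where "r = (\<Prod>x\<in>X. [:- x, 1:])"
  have r: "poly r x = 0" if "x \<in> X" for x
    using insert.hyps that by (auto simp: r_def poly_prod)
  have ra: "poly r a \<noteq> 0"
    using insert.hyps by (auto simp: r_def poly_prod)
  have "\<forall>x\<in>insert a X. poly (q + smult ((f a - poly q a) / poly r a) r) x = f x"
    using q r ra by auto
  thus ?case by blast
qed simp

text \<open>\<open>Q\<close> stands for the inverse of \<open>P\<close>. It is a separate argument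
  because the linear laws hold for any \<open>Q\<close>; the two inverse equations are assumed from
  the laws for constants and products on.\<close>

definition conj_diag :: "complex^'n^'n \<Rightarrow> complex^'n^'n \<Rightarrow> ('n \<Rightarrow> complex) \<Rightarrow> complex^'n^'n" where
  "conj_diag P Q f = P ** diag_matrix (\<chi> i. f i) ** Q"

lemma conj_diag_nth: "conj_diag P Q f $ a $ b = (\<Sum>i\<in>UNIV. P $ a $ i * f i * Q $ i $ b)"
  unfolding conj_diag_def matrix_matrix_mult_def diag_matrix_def
  by (simp add: if_distrib if_distribR cong: if_cong)

lemma diag_matrix_mult_vec: "(diag_matrix v *v x) $ i = v $ i * x $ i"
  by (simp add: matrix_vector_mult_def diag_matrix_def if_distrib if_distribR cong: if_cong)

lemma conj_diag_add: "conj_diag P Q f + conj_diag P Q g = conj_diag P Q (\<lambda>i. f i + g i)"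
  by (simp add: vec_eq_iff conj_diag_nth algebra_simps sum.distrib)

lemma conj_diag_diff: "conj_diag P Q f - conj_diag P Q g = conj_diag P Q (\<lambda>i. f i - g i)"
  by (simp add: vec_eq_iff conj_diag_nth algebra_simps sum_subtractf)

lemma conj_diag_minus: "- conj_diag P Q f = conj_diag P Q (\<lambda>i. - f i)"
  by (simp add: vec_eq_iff conj_diag_nth sum_negf)

lemma conj_diag_zero: "conj_diag P Q (\<lambda>i. 0) = 0"
  by (simp add: vec_eq_iff conj_diag_nth)

lemma conj_diag_sum: "(\<Sum>k\<in>K. conj_diag P Q (f k)) = conj_diag P Q (\<lambda>i. \<Sum>k\<in>K. f k i)"
  by (induction K rule: infinite_finite_induct) (simp_all add: conj_diag_zero conj_diag_add)

lemma conj_diag_scaleR: "c *\<^sub>R conj_diag P Q f = conj_diag P Q (\<lambda>i. c *\<^sub>R f i)"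
  by (simp add: vec_eq_iff conj_diag_nth scaleR_sum_right)

lemma conj_diag_sums:
  assumes "\<And>i. (\<lambda>k. f k i) sums s i"
  shows "(\<lambda>k. conj_diag P Q (f k)) sums conj_diag P Q s"
  unfolding sums_def conj_diag_sum
proof (intro vec_tendstoI)
  fix a b
  show "(\<lambda>n. conj_diag P Q (\<lambda>i. \<Sum>k<n. f k i) $ a $ b) \<longlonglongrightarrow> conj_diag P Q s $ a $ b"
    unfolding conj_diag_nth using assms unfolding sums_def by (intro tendsto_intros) auto
qed

context
  fixes P Q :: "complex^'n^'n"
  assumes PQ: "P ** Q = mat 1" and QP: "Q ** P = mat 1"
begin

lemma conj_diag_const: "conj_diag P Q (\<lambda>i. c) = mat c"
proof -
  have "conj_diag P Q (\<lambda>i. c) $ a $ b = mat c $ a $ b" for a b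
  proof -
    have "conj_diag P Q (\<lambda>i. c) $ a $ b = c * (P ** Q) $ a $ b"
      by (simp add: conj_diag_nth matrix_matrix_mult_def sum_distrib_left mult_ac)
    thus ?thesis unfolding PQ by (simp add: mat_def)
  qed
  thus ?thesis by (simp add: vec_eq_iff)
qed

lemma conj_diag_mult: "conj_diag P Q f ** conj_diag P Q g = conj_diag P Q (\<lambda>i. f i * g i)"
proof -
  have delta: "(\<Sum>k\<in>UNIV. (if i = k then u k else 0) * h k) = u i * h i" for i :: 'n and u h :: "'n \<Rightarrow> complex"
    by (simp add: if_distrib[of "\<lambda>t. t * _"] cong: if_cong)
  have "diag_matrix (\<chi> i. f i) ** diag_matrix (\<chi> i. g i) = diag_matrix (\<chi> i. f i * g i)"
    unfolding vec_eq_iff matrix_matrix_mult_def diag_matrix_def vec_lambda_beta delta by simp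
  moreover have "conj_diag P Q f ** conj_diag P Q g
      = P ** (diag_matrix (\<chi> i. f i) ** (Q ** P) ** diag_matrix (\<chi> i. g i)) ** Q"
    unfolding conj_diag_def by (simp only: matrix_mul_assoc)
  ultimately show ?thesis
    unfolding QP by (simp add: conj_diag_def)
qed

lemma matrix_inv_conj_diag:
  assumes "\<And>i. f i \<noteq> 0"
  shows "matrix_inv (conj_diag P Q f) = conj_diag P Q (\<lambda>i. inverse (f i))"
  using assms by (intro matrix_inv_unique) (simp_all add: conj_diag_mult conj_diag_const)

lemma mat_pow_conj_diag: "mat_pow (conj_diag P Q f) k = conj_diag P Q (\<lambda>i. f i ^ k)"
  by (induction k) (simp_all add: mat_pow_def conj_diag_const conj_diag_mult)

lemma poly_matrix_conj_diag: "poly_matrix q (conj_diag P Q f) = conj_diag P Q (\<lambda>i. poly q (f i))"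
  by (simp add: poly_matrix_def mat_pow_conj_diag conj_diag_mult conj_diag_sum poly_altdef
      flip: conj_diag_const)

lemma exp_matrix_conj_diag: "exp_matrix (conj_diag P Q f) = conj_diag P Q (\<lambda>i. exp (f i))"
proof -
  have "(\<lambda>k. conj_diag P Q (\<lambda>i. (1 / fact k) *\<^sub>R f i ^ k)) sums conj_diag P Q (\<lambda>i. exp (f i))"
    using exp_converges by (intro conj_diag_sums) (simp add: inverse_eq_divide)
  thus ?thesis
    unfolding exp_matrix_def mat_pow_conj_diag conj_diag_scaleR by (rule sums_unique[symmetric])
qed

lemma conj_diag_mult_vec: "conj_diag P Q f *v x = P *v (\<chi> i. f i * (Q *v x) $ i)"
  by (simp add: conj_diag_def vec_eq_iff diag_matrix_mult_vec flip: matrix_vector_mul_assoc)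
     (metis (no_types, lifting) diag_matrix_mult_vec vec_lambda_beta vec_lambda_unique)

lemma conj_diag_mult_vec_eq_iff:
  "conj_diag P Q f *v x = z *s x \<longleftrightarrow> (\<forall>i. f i * (Q *v x) $ i = z * (Q *v x) $ i)"
proof -
  have inj: "Q *v u = Q *v v \<longleftrightarrow> u = v" for u v
    by (metis PQ matrix_vector_mul_assoc matrix_vector_mul_lid)
  have "conj_diag P Q f *v x = z *s x \<longleftrightarrow> Q *v (conj_diag P Q f *v x) = Q *v (z *s x)"
    by (simp only: inj)
  also have "Q *v (conj_diag P Q f *v x) = (\<chi> i. f i * (Q *v x) $ i)"
    unfolding conj_diag_mult_vec matrix_vector_mul_assoc QP by simp
  also have "Q *v (z *s x) = z *s (Q *v x)"
    by (rule vector_scalar_commute)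
  finally show ?thesis by (simp add: vec_eq_iff)
qed

lemma column_nonzero: "P *v axis i 1 \<noteq> 0"
proof
  assume "P *v axis i 1 = 0"
  hence "Q *v (P *v axis i 1) = 0" by simp
  hence "axis i (1 :: complex) = 0" by (simp add: matrix_vector_mul_assoc QP)
  thus False by (simp add: axis_eq_0_iff)
qed

lemma conj_diag_mult_column: "conj_diag P Q f *v (P *v axis i 1) = f i *s (P *v axis i 1)"
  unfolding conj_diag_mult_vec_eq_iff by (simp add: matrix_vector_mul_assoc QP axis_def)

lemma mat_spectrum_conj_diag: "mat_spectrum (conj_diag P Q f) = range f"
proof (intro equalityI subsetI)
  fix z assume "z \<in> mat_spectrum (conj_diag P Q f)"
  then obtain x where x: "x \<noteq> 0" "conj_diag P Q f *v x = z *s x"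
    by (auto simp: mat_spectrum_def)
  have "Q *v x \<noteq> 0"
    using x(1) by (metis PQ matrix_vector_mul_assoc matrix_vector_mul_lid matrix_vector_mult_0_right)
  then obtain i where "(Q *v x) $ i \<noteq> 0" by (auto simp: vec_eq_iff)
  moreover have "f i * (Q *v x) $ i = z * (Q *v x) $ i"
    using x(2) unfolding conj_diag_mult_vec_eq_iff by blast
  ultimately show "z \<in> range f" by auto
next
  fix z assume "z \<in> range f"
  thus "z \<in> mat_spectrum (conj_diag P Q f)"
    unfolding mat_spectrum_def using column_nonzero conj_diag_mult_column by blast
qed

text \<open>For \<open>k \<ge> 1\<close> the power \<open>(f j - f i) ^ k\<close> vanishes exactly
  when \<open>f j = f i\<close>, so all these powers have the same kernel. The power 0 has trivial
  kernel, whereas column \<open>i\<close> of \<open>P\<close> is an eigenvector; hence the least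
  exponent is 1 and not 0.\<close>

lemma eig_index_conj_diag: "eig_index (conj_diag P Q f) (f i) = 1"
proof -
  define N where "N = (\<lambda>k. conj_diag P Q (\<lambda>j. (f j - f i) ^ k))"
  have N: "mat_pow (conj_diag P Q f - mat (f i)) k = N k" for k
    by (simp add: N_def conj_diag_diff mat_pow_conj_diag flip: conj_diag_const)
  have ker: "N k *v x = 0 \<longleftrightarrow> (\<forall>j. (f j - f i) ^ k * (Q *v x) $ j = 0)" for k x
    using conj_diag_mult_vec_eq_iff[of _ x 0] by (simp add: N_def)
  show ?thesis
    unfolding eig_index_def N
  proof (rule Least_equality)
    show "{x. N 1 *v x = 0} = {x. N (Suc 1) *v x = 0}" by (simp add: ker)
    fix k assume k: "{x. N k *v x = 0} = {x. N (Suc k) *v x = 0}"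
    have "k \<noteq> 0"
    proof
      assume "k = 0"
      have "P *v axis i 1 \<in> {x. N (Suc 0) *v x = 0}"
        using conj_diag_mult_column[of "\<lambda>j. (f j - f i) ^ Suc 0" i] by (simp add: N_def)
      with k \<open>k = 0\<close> have "N 0 *v (P *v axis i 1) = 0" by blast
      thus False using column_nonzero[of i] by (simp add: N_def conj_diag_const)
    qed
    thus "1 \<le> k" by simp
  qed
qed

text \<open>As every index is 1, interpolation concerns only the values on the finite set
  \<open>range f\<close>. Repeated eigenvalues cause no conflict, and every admissible polynomial
  yields the same diagonal.\<close>

lemma primary_matrix_fun_conj_diag:
  "primary_matrix_fun h (conj_diag P Q f) = conj_diag P Q (\<lambda>i. h (f i))"
proof -
  have interp: "interpolates_on_spectrum q h (conj_diag P Q f) \<longleftrightarrow> (\<forall>x\<in>range f. poly q x = h x)" for q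
    by (auto simp: interpolates_on_spectrum_def mat_spectrum_conj_diag eig_index_conj_diag)
  have "\<exists>q. interpolates_on_spectrum q h (conj_diag P Q f)"
    unfolding interp by (rule exists_interpolating_poly) simp
  hence "interpolates_on_spectrum (SOME q. interpolates_on_spectrum q h (conj_diag P Q f)) h (conj_diag P Q f)"
    by (rule someI_ex)
  thus ?thesis
    unfolding primary_matrix_fun_def poly_matrix_conj_diag unfolding interp by simp
qed

text \<open>Every operation in the matrix formula acts on the diagonal alone, which turns it into
  the scalar formula entry by entry. Positive real parts keep the shifts by
  \<open>k - 1 \<ge> 0\<close> invertible.\<close>

lemma spouge_matrix_conj_diag:
  assumes "\<And>i. Re (f i) > 0"
  shows "spouge_matrix a (conj_diag P Q f) = conj_diag P Q (\<lambda>i. spouge_scalar a (f i))"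
proof -
  have inv: "matrix_inv (conj_diag P Q (\<lambda>i. f i + of_real (real k - 1)))
      = conj_diag P Q (\<lambda>i. inverse (f i + of_real (real k - 1)))" if "k \<in> {1..spouge_terms a}" for k
  proof (rule matrix_inv_conj_diag)
    fix i
    have "Re (f i + of_real (real k - 1)) > 0" using assms[of i] that by simp
    thus "f i + of_real (real k - 1) \<noteq> 0" by (metis less_irrefl zero_complex.sel(1))
  qed
  have "spouge_matrix a (conj_diag P Q f) =
     conj_diag P Q (\<lambda>i. of_real (sqrt (2 * pi)))
     ** conj_diag P Q (\<lambda>i. exp (Ln (f i + of_real (a - 1)) * (f i - 1/2)))
     ** conj_diag P Q (\<lambda>i. exp (- (f i + of_real (a - 1))))
     ** (conj_diag P Q (\<lambda>i. of_real (spouge_coeff a 0))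
         + (\<Sum>k = 1..spouge_terms a. conj_diag P Q (\<lambda>i. of_real (spouge_coeff a k))
              ** conj_diag P Q (\<lambda>i. inverse (f i + of_real (real k - 1)))))"
    unfolding spouge_matrix_def powr_matrix_def log_matrix_def conj_diag_const[symmetric]
      conj_diag_add conj_diag_diff conj_diag_minus primary_matrix_fun_conj_diag
      conj_diag_mult exp_matrix_conj_diag
    by (intro arg_cong2[of _ _ _ _ "(**)"] arg_cong2[of _ _ _ _ "(+)"] sum.cong refl)
       (simp only: inv conj_diag_mult)
  thus ?thesis
    unfolding conj_diag_mult conj_diag_sum conj_diag_add by (simp only: spouge_scalar_def)
qed

end


subsection \<open>Matrix norms of diagonalizable matrices\<close>

context
  fixes p :: ereal
  assumes p: "p = \<infinity> \<or> real_of_ereal p > 0"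
begin

text \<open>The matrix estimates rest on this monotonicity and on homogeneity: together they bound a
  diagonal matrix by its largest entry, for all the norms at once.\<close>

lemma vec_pnorm_mono:
  assumes "\<And>i. norm (x $ i) \<le> norm (y $ i)"
  shows "vec_pnorm p x \<le> vec_pnorm p y"
proof (cases "p = \<infinity>")
  case True
  have "Max (range (\<lambda>i. cmod (x $ i))) \<le> Max (range (\<lambda>i. cmod (y $ i)))"
    using assms by (subst Max_le_iff) (auto intro!: order_trans[OF assms Max_ge])
  thus ?thesis using True by (simp add: vec_pnorm_def)
next
  case False
  thus ?thesis using p assms unfolding vec_pnorm_def
    by (auto intro!: powr_mono2 sum_mono sum_nonneg)
qed

lemma vec_pnorm_smult: "vec_pnorm p (c *s x) = norm c * vec_pnorm p x"
proof (cases "p = \<infinity>")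
  case True
  have "Max (range (\<lambda>i. cmod c * cmod (x $ i))) = Max ((\<lambda>t. cmod c * t) ` range (\<lambda>i. cmod (x $ i)))"
    by (simp add: image_image)
  also have "\<dots> = cmod c * Max (range (\<lambda>i. cmod (x $ i)))"
    by (rule mono_Max_commute[symmetric]) (auto intro!: monoI mult_left_mono)
  finally show ?thesis using True by (simp add: vec_pnorm_def norm_mult)
next
  case False
  define r where "r = real_of_ereal p"
  have r: "r > 0" using False p by (simp add: r_def)
  have "(\<Sum>i\<in>UNIV. cmod (c * x $ i) powr r) = norm c powr r * (\<Sum>i\<in>UNIV. cmod (x $ i) powr r)"
    by (simp add: norm_mult powr_mult sum_distrib_left)
  hence "(\<Sum>i\<in>UNIV. cmod (c * x $ i) powr r) powr (1 / r)
      = (norm c powr r) powr (1 / r) * (\<Sum>i\<in>UNIV. cmod (x $ i) powr r) powr (1 / r)"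
    by (simp add: powr_mult sum_nonneg)
  moreover have "(norm c powr r) powr (1 / r) = norm c"
    using r by (simp add: powr_powr)
  ultimately show ?thesis using False by (simp add: vec_pnorm_def r_def)
qed

lemma norm_nth_le_vec_pnorm: "norm (x $ i) \<le> vec_pnorm p x"
proof (cases "p = \<infinity>")
  case True
  thus ?thesis by (simp add: vec_pnorm_def)
next
  case False
  define r where "r = real_of_ereal p"
  have r: "r > 0" using False p by (simp add: r_def)
  have "norm (x $ i) = (norm (x $ i) powr r) powr (1 / r)"
    using r by (simp add: powr_powr)
  also have "\<dots> \<le> (\<Sum>i\<in>UNIV. norm (x $ i) powr r) powr (1 / r)"
    using r by (intro powr_mono2 member_le_sum) auto
  finally show ?thesis using False by (simp add: vec_pnorm_def r_def)
qed

lemma vec_pnorm_nonneg: "vec_pnorm p x \<ge> 0"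
  by (rule order_trans[OF norm_ge_zero norm_nth_le_vec_pnorm[of x undefined]])

lemma vec_pnorm_pos:
  assumes "x \<noteq> 0"
  shows "vec_pnorm p x > 0"
proof -
  obtain i where "x $ i \<noteq> 0" using assms by (auto simp: vec_eq_iff)
  thus ?thesis using norm_nth_le_vec_pnorm[of x i] by (meson less_le_trans zero_less_norm_iff)
qed

text \<open>\<open>mat_pnorm\<close> is a supremum of reals and dominates its quotients once they
  are known to be bounded. A crude constant is enough: every entry of \<open>A *v x\<close> is at
  most \<open>B * vec_pnorm p x\<close>, so the vector is dominated by a multiple of the all-ones
  vector \<open>e\<close>.\<close>

lemma vec_pnorm_mult_bounded:
  fixes A :: "complex^'n^'n"
  shows "\<exists>K. \<forall>x. vec_pnorm p (A *v x) \<le> K * vec_pnorm p x"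
proof (intro exI allI)
  fix x :: "complex^'n"
  define e :: "complex^'n" where "e = (\<chi> i. 1)"
  define B where "B = (\<Sum>i\<in>UNIV. \<Sum>j\<in>UNIV. norm (A $ i $ j))"
  have row: "norm ((A *v x) $ i) \<le> B * vec_pnorm p x" for i
  proof -
    have "norm ((A *v x) $ i) \<le> (\<Sum>j\<in>UNIV. norm (A $ i $ j * x $ j))"
      unfolding matrix_vector_mult_def vec_lambda_beta by (rule norm_sum)
    also have "\<dots> \<le> (\<Sum>j\<in>UNIV. norm (A $ i $ j) * vec_pnorm p x)"
      unfolding norm_mult by (intro sum_mono mult_left_mono norm_nth_le_vec_pnorm) auto
    also have "\<dots> = (\<Sum>j\<in>UNIV. norm (A $ i $ j)) * vec_pnorm p x"
      by (simp add: sum_distrib_right)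
    also have "\<dots> \<le> B * vec_pnorm p x"
      unfolding B_def
      by (intro mult_right_mono vec_pnorm_nonneg member_le_sum[of i UNIV "\<lambda>i. \<Sum>j\<in>UNIV. norm (A $ i $ j)"])
         (auto intro: sum_nonneg)
    finally show ?thesis .
  qed
  have "B \<ge> 0" unfolding B_def by (intro sum_nonneg) auto
  have "vec_pnorm p (A *v x) \<le> vec_pnorm p (of_real (B * vec_pnorm p x) *s e)"
  proof (rule vec_pnorm_mono)
    fix i
    show "norm ((A *v x) $ i) \<le> norm ((of_real (B * vec_pnorm p x) *s e) $ i)"
      using row[of i] \<open>B \<ge> 0\<close> vec_pnorm_nonneg[of x] by (simp add: norm_mult e_def)
  qed
  also have "\<dots> = B * vec_pnorm p e * vec_pnorm p x"
    using \<open>B \<ge> 0\<close> vec_pnorm_nonneg[of x] unfolding vec_pnorm_smult norm_of_real by simp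
  finally show "vec_pnorm p (A *v x)
      \<le> (\<Sum>i\<in>UNIV. \<Sum>j\<in>UNIV. norm (A $ i $ j)) * vec_pnorm p ((\<chi> i. 1) :: complex^'n) * vec_pnorm p x"
    unfolding B_def e_def .
qed

lemma vec_pnorm_mult_le:
  fixes A :: "complex^'n^'n"
  shows "vec_pnorm p (A *v x) \<le> mat_pnorm p A * vec_pnorm p x"
proof (cases "x = 0")
  case True
  moreover have "vec_pnorm p (0 :: complex^'n) = 0"
    using vec_pnorm_smult[of 0 "0 :: complex^'n"] by simp
  ultimately show ?thesis by simp
next
  case False
  obtain K where K: "\<And>x. vec_pnorm p (A *v x) \<le> K * vec_pnorm p x"
    using vec_pnorm_mult_bounded by blast
  have "vec_pnorm p (A *v x) / vec_pnorm p x \<le> mat_pnorm p A"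
    unfolding mat_pnorm_def
  proof (rule cSUP_upper)
    show "bdd_above ((\<lambda>x. vec_pnorm p (A *v x) / vec_pnorm p x) ` {x. x \<noteq> 0})"
    proof (rule bdd_aboveI2)
      fix x :: "complex^'n" assume "x \<in> {x. x \<noteq> 0}"
      thus "vec_pnorm p (A *v x) / vec_pnorm p x \<le> K"
        using K[of x] vec_pnorm_pos[of x] by (simp add: pos_divide_le_eq)
    qed
  qed (use False in simp)
  thus ?thesis using vec_pnorm_pos[OF False] by (simp add: pos_divide_le_eq)
qed

lemma mat_pnorm_leI:
  fixes A :: "complex^'n^'n"
  assumes "\<And>x. vec_pnorm p (A *v x) \<le> c * vec_pnorm p x"
  shows "mat_pnorm p A \<le> c"
  unfolding mat_pnorm_def
proof (rule cSUP_least)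
  have "axis undefined 1 \<in> {x :: complex^'n. x \<noteq> 0}" by (simp add: axis_eq_0_iff)
  thus "{x :: complex^'n. x \<noteq> 0} \<noteq> {}" by blast
next
  fix x :: "complex^'n" assume "x \<in> {x. x \<noteq> 0}"
  thus "vec_pnorm p (A *v x) / vec_pnorm p x \<le> c"
    using assms[of x] vec_pnorm_pos[of x] by (simp add: pos_divide_le_eq)
qed

lemma mat_pnorm_nonneg:
  fixes A :: "complex^'n^'n"
  shows "mat_pnorm p A \<ge> 0"
proof -
  define x :: "complex^'n" where "x = axis undefined 1"
  have "x \<noteq> 0" by (simp add: x_def)
  hence pos: "vec_pnorm p x > 0" by (rule vec_pnorm_pos)
  have "0 \<le> mat_pnorm p A * vec_pnorm p x"
    by (rule order_trans[OF vec_pnorm_nonneg vec_pnorm_mult_le])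
  thus ?thesis using pos by (simp add: zero_le_mult_iff)
qed

lemma mat_pnorm_conj_diag_le:
  assumes "\<And>i. norm (f i) \<le> c"
  shows "mat_pnorm p (conj_diag P Q f) \<le> mat_pnorm p P * mat_pnorm p Q * c"
proof (rule mat_pnorm_leI)
  fix x
  have c: "c \<ge> 0" by (rule order_trans[OF norm_ge_zero assms])
  have "conj_diag P Q f *v x = P *v (diag_matrix (\<chi> i. f i) *v (Q *v x))"
    by (simp only: conj_diag_def matrix_vector_mul_assoc matrix_mul_assoc)
  also have "vec_pnorm p \<dots> \<le> mat_pnorm p P * vec_pnorm p (diag_matrix (\<chi> i. f i) *v (Q *v x))"
    by (rule vec_pnorm_mult_le)
  also have "\<dots> \<le> mat_pnorm p P * (c * vec_pnorm p (Q *v x))"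
  proof (intro mult_left_mono mat_pnorm_nonneg)
    have "vec_pnorm p (diag_matrix (\<chi> i. f i) *v (Q *v x)) \<le> vec_pnorm p (of_real c *s (Q *v x))"
      by (rule vec_pnorm_mono) (use assms c in \<open>simp add: diag_matrix_mult_vec norm_mult mult_right_mono\<close>)
    thus "vec_pnorm p (diag_matrix (\<chi> i. f i) *v (Q *v x)) \<le> c * vec_pnorm p (Q *v x)"
      using c by (simp add: vec_pnorm_smult)
  qed
  also have "\<dots> \<le> mat_pnorm p P * (c * (mat_pnorm p Q * vec_pnorm p x))"
    using c by (intro mult_left_mono mat_pnorm_nonneg vec_pnorm_mult_le)
  finally show "vec_pnorm p (conj_diag P Q f *v x) \<le> mat_pnorm p P * mat_pnorm p Q * c * vec_pnorm p x"
    by (simp add: mult_ac)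
qed

text \<open>Column \<open>i\<close> of \<open>P\<close> is an eigenvector for \<open>f i\<close>,
  and an operator norm dominates the modulus of every eigenvalue.\<close>

lemma norm_le_mat_pnorm_conj_diag:
  assumes "P ** Q = mat 1" "Q ** P = mat 1"
  shows "norm (f i) \<le> mat_pnorm p (conj_diag P Q f)"
proof -
  define x where "x = P *v axis i 1"
  have "vec_pnorm p x > 0" unfolding x_def by (intro vec_pnorm_pos column_nonzero[OF assms])
  moreover have "norm (f i) * vec_pnorm p x \<le> mat_pnorm p (conj_diag P Q f) * vec_pnorm p x"
    using vec_pnorm_mult_le[of "conj_diag P Q f" x]
    unfolding x_def conj_diag_mult_column[OF assms] vec_pnorm_smult .
  ultimately show ?thesis by simp
qed

end


theorem lemma2:
  fixes p :: ereal and a :: real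
    and A P D :: "complex^'n^'n" and l :: "complex^'n"
  assumes "p \<in> {1, 2, \<infinity>}"
    and "invertible P"
    and "D = diag_matrix l"
    and "A = P ** D ** matrix_inv P"
    and "min_re_spectrum A > 0"
    and "a \<ge> 3"
  shows "spouge_rel_error p a A
           \<le> cond_num p P * (sqrt a / ((2 * pi) powr (a - 1 / 2) * (min_re_spectrum A - 1 + a)))"
proof -
  \<comment> \<open>\<open>real_of_ereal \<infinity>\<close> is 0, hence the separate case.\<close>
  have p: "p = \<infinity> \<or> real_of_ereal p > 0" using assms(1) by auto
  define Q where "Q = matrix_inv P"
  have PQ: "P ** Q = mat 1" "Q ** P = mat 1"
    using matrix_inv_inverse[OF assms(2)] by (simp_all add: Q_def)
  have A: "A = conj_diag P Q (\<lambda>i. l $ i)"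
    using assms by (simp add: conj_diag_def Q_def)
  define m where "m = min_re_spectrum A"
  have m: "m > 0" "m \<le> Re (l $ i)" for i
    using assms(5) by (auto simp: m_def min_re_spectrum_def A mat_spectrum_conj_diag[OF PQ] image_image)
  have Re: "Re (l $ i) > 0" for i using m(1) m(2)[of i] by simp
  define \<beta> where "\<beta> = sqrt a / ((2 * pi) powr (a - 1/2) * (m - 1 + a))"
  have \<beta>: "\<beta> \<ge> 0" using assms m by (simp add: \<beta>_def)
  \<comment> \<open>The scalar errors are not divided one by one: each is at most
    \<open>\<beta> * M\<close>, and \<open>M\<close>, attained at an eigenvalue, is at most the norm
    of \<open>Gamma_matrix A\<close>.\<close>
  define M where "M = Max (range (\<lambda>i. norm (Gamma (l $ i))))"
  have M: "norm (Gamma (l $ i)) \<le> M" for i unfolding M_def by (intro Max_ge) auto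
  have "M \<in> range (\<lambda>i. norm (Gamma (l $ i)))" unfolding M_def by (intro Max_in) auto
  then obtain i0 where i0: "M = norm (Gamma (l $ i0))" by blast
  have "l $ i0 \<noteq> 0" using Re[of i0] by (metis less_irrefl zero_complex.sel(1))
  hence "l $ i0 \<notin> \<int>\<^sub>\<le>\<^sub>0" using Re[of i0] by (intro not_nonpos_Int_Re_nonneg) auto
  hence "Gamma (l $ i0) \<noteq> 0" by (simp add: Gamma_eq_zero_iff)
  hence M0: "M > 0" by (simp add: i0)
  have G: "Gamma_matrix A = conj_diag P Q (\<lambda>i. Gamma (l $ i))"
    unfolding Gamma_matrix_def A primary_matrix_fun_conj_diag[OF PQ] ..
  have S: "spouge_matrix a A = conj_diag P Q (\<lambda>i. spouge_scalar a (l $ i))"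
    unfolding A using Re by (intro spouge_matrix_conj_diag[OF PQ])
  have "norm (Gamma (l $ i) - spouge_scalar a (l $ i)) \<le> \<beta> * M" for i
  proof -
    have "norm (Gamma (l $ i) - spouge_scalar a (l $ i))
        \<le> norm (Gamma (l $ i)) * (sqrt a / ((2 * pi) powr (a - 1/2) * (Re (l $ i) - 1 + a)))"
      using assms Re by (intro spouge_scalar_error)
    \<comment> \<open>The scalar bound decreases in the real part of the eigenvalue, so the smallest
      real part \<open>m\<close> is the worst case.\<close>
    also have "\<dots> \<le> M * \<beta>"
      unfolding \<beta>_def using assms m(1) m(2)[of i] M0
      by (intro mult_mono M divide_left_mono mult_left_mono mult_pos_pos) auto
    finally show ?thesis by (simp add: mult.commute)
  qed
  hence "mat_pnorm p (Gamma_matrix A - spouge_matrix a A) \<le> mat_pnorm p P * mat_pnorm p Q * (\<beta> * M)"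
    unfolding G S conj_diag_diff by (rule mat_pnorm_conj_diag_le[OF p])
  also have "\<dots> = cond_num p P * \<beta> * M" by (simp add: cond_num_def Q_def)
  also have "\<dots> \<le> cond_num p P * \<beta> * mat_pnorm p (Gamma_matrix A)"
    unfolding G i0 cond_num_def
    by (intro mult_left_mono mult_nonneg_nonneg \<beta> mat_pnorm_nonneg[OF p]
          norm_le_mat_pnorm_conj_diag[OF p PQ, of "\<lambda>i. Gamma (l $ i)"])
  finally have "mat_pnorm p (Gamma_matrix A - spouge_matrix a A) \<le> cond_num p P * \<beta> * mat_pnorm p (Gamma_matrix A)" .
  moreover have "mat_pnorm p (Gamma_matrix A) > 0"
    using M0 norm_le_mat_pnorm_conj_diag[OF p PQ, of "\<lambda>i. Gamma (l $ i)" i0]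
    unfolding G i0 by linarith
  ultimately show ?thesis
    unfolding spouge_rel_error_def \<beta>_def m_def by (simp add: pos_divide_le_eq)
qed

end
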